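(* Let $N=(G,u,b,\tau,T)$ be an undirected network over time with a single source or a single sink, in which $B=\sum_{v:\,b_v>0}b_v$ units of flow can be sent within the time horizon $T$. Then there exists an orientation $\overrightarrow{N}$ of $N$ in which at least $B/2$ units of flow can be sent within time horizon $T$. Moreover, this bound is tight: for every constant $c>1/2$ there are undirected networks over time with a single source (and also ones with a single sink) in which $B$ units can be sent within time horizon $T$ but in every orientation fewer than $cB$ units can be sent within time horizon $T$.
   Context: An undirected network over time $N=(G,u,b,\tau,T)$ consists of a finite undirected (multi)graph $G=(V,E)$, capacities $u_e\ge 0$ and transit times $\tau_e\ge 0$ for $e\in E$, balances $b_v\in\mathbb{R}$ with $\sum_v b_v=0$, and a time horizon $T\ge 0$. Sources are $S^+=\{v: b_v>0\}$, sinks $S^-=\{v:b_v<0\}$. An orientation of $N$ replaces every edge $\{v,w\}$ by exactly one of the arcs $(v,w),(w,v)$ with the same capacity and transit time (parallel edges oriented independently). A flow over time in a directed network assigns to each arc $e$ a Lebesgue-integrable inflow rate $f_e:[0,T)\to\mathbb{R}_{\ge0}$ with $f_e\le u_e$ and $f_e(\theta)=0$ for $\theta\ge T-\tau_e$; flow entering at $\theta$ leaves at $\theta+\tau_e$. With excess $\mathrm{ex}(v,\theta)=\sum_{e\in\delta^-(v)}\int_0^{\theta-\tau_e}f_e-\sum_{e\in\delta^+(v)}\int_0^{\theta}f_e$, flow conservation requires: $\mathrm{ex}(v,T)=0$ and $\mathrm{ex}(v,\theta)\ge0$ for non-terminals; $-b_v\le\mathrm{ex}(v,\theta)\le0$ for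 sources; $0\le\mathrm{ex}(v,\theta)\le-b_v$ for sinks. The value is $|f|=\sum_{v\in S^-}\mathrm{ex}(v,T)$. In an undirected network flow may use each edge in both directions, the inflow rates in both directions together bounded by $u_e$, each direction with transit time $\tau_e$. "$x$ units of flow can be sent within time horizon $T$" means a flow over time with horizon $T$ satisfying these constraints and of value at least $x$ exists. *)

theory Defs
  imports "HOL-Analysis.Analysis" "Graph_Theory.Digraph"
begin

text \<open>Finite undirected multigraphs: edges carry an identity of their own, so parallel edges are
  possible; an edge with \<open>ends e = {v}\<close> is a loop.\<close>

record ('v, 'e) ugraph =
  nodes :: "'v set"
  edges :: "'e set"
  ends :: "'e \<Rightarrow> 'v set"

text \<open>The type \<open>'g\<close> of the underlying graph is \<^typ>\<open>('v, 'e) ugraph\<close> for undirected and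
  \<^typ>\<open>('v, 'e) pre_digraph\<close> for directed networks.\<close>

record ('g, 'v, 'e) network =
  graph :: 'g
  capacity :: "'e \<Rightarrow> real"
  balance :: "'v \<Rightarrow> real"
  transit :: "'e \<Rightarrow> real"
  horizon :: real

type_synonym ('v, 'e) unetwork = "(('v, 'e) ugraph, 'v, 'e) network"
type_synonym ('v, 'a) dnetwork = "(('v, 'a) pre_digraph, 'v, 'a) network"

locale undirected_network =
  fixes N :: "('v, 'e) unetwork"
  assumes finite_nodes: "finite (nodes (graph N))"
    and finite_edges: "finite (edges (graph N))"
    and ends: "e \<in> edges (graph N) \<Longrightarrow>
      \<exists>v\<in>nodes (graph N). \<exists>w\<in>nodes (graph N). ends (graph N) e = {v, w}"
    and capacity_nonneg: "e \<in> edges (graph N) \<Longrightarrow> 0 \<le> capacity N e"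
    and transit_nonneg: "e \<in> edges (graph N) \<Longrightarrow> 0 \<le> transit N e"
    and balance_sum: "(\<Sum>v\<in>nodes (graph N). balance N v) = 0"
    and horizon_nonneg: "0 \<le> horizon N"

definition sources :: "('v, 'e) unetwork \<Rightarrow> 'v set" where
  "sources N = {v \<in> nodes (graph N). balance N v > 0}"

definition sinks :: "('v, 'e) unetwork \<Rightarrow> 'v set" where
  "sinks N = {v \<in> nodes (graph N). balance N v < 0}"

definition total_supply :: "('v, 'e) unetwork \<Rightarrow> real" where
  "total_supply N = (\<Sum>v\<in>sources N. balance N v)"

text \<open>In the excess, the upper limit \<open>\<theta> - \<tau>\<^sub>e\<close> may be negative, in which case the
  interval of integration is empty.  Only values of the inflow rates on \<open>[0, T)\<close> matter.\<close>

definition excess :: "('v, 'a) dnetwork \<Rightarrow> ('a \<Rightarrow> real \<Rightarrow> real) \<Rightarrow> 'v \<Rightarrow> real \<Rightarrow> real" where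
  "excess M f v \<theta> =
     (\<Sum>a\<in>in_arcs (graph M) v. LINT t:{0..<\<theta> - transit M a}|lebesgue. f a t)
     - (\<Sum>a\<in>out_arcs (graph M) v. LINT t:{0..<\<theta>}|lebesgue. f a t)"

definition conserves_at :: "('v, 'a) dnetwork \<Rightarrow> ('a \<Rightarrow> real \<Rightarrow> real) \<Rightarrow> 'v \<Rightarrow> bool" where
  "conserves_at M f v \<longleftrightarrow>
     (balance M v = 0 \<longrightarrow>
        excess M f v (horizon M) = 0 \<and> (\<forall>\<theta>\<in>{0..horizon M}. 0 \<le> excess M f v \<theta>)) \<and>
     (balance M v > 0 \<longrightarrow>
        (\<forall>\<theta>\<in>{0..horizon M}. - balance M v \<le> excess M f v \<theta> \<and> excess M f v \<theta> \<le> 0)) \<and>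
     (balance M v < 0 \<longrightarrow>
        (\<forall>\<theta>\<in>{0..horizon M}. 0 \<le> excess M f v \<theta> \<and> excess M f v \<theta> \<le> - balance M v))"

definition flow_over_time :: "('v, 'a) dnetwork \<Rightarrow> ('a \<Rightarrow> real \<Rightarrow> real) \<Rightarrow> bool" where
  "flow_over_time M f \<longleftrightarrow>
     (\<forall>a\<in>arcs (graph M).
        f a absolutely_integrable_on {0..<horizon M} \<and>
        (\<forall>\<theta>\<in>{0..<horizon M}. 0 \<le> f a \<theta> \<and> f a \<theta> \<le> capacity M a \<and>
           (horizon M - transit M a \<le> \<theta> \<longrightarrow> f a \<theta> = 0))) \<and>
     (\<forall>v\<in>verts (graph M). conserves_at M f v)"

definition flow_value :: "('v, 'a) dnetwork \<Rightarrow> ('a \<Rightarrow> real \<Rightarrow> real) \<Rightarrow> real" where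
  "flow_value M f =
     (\<Sum>v | v \<in> verts (graph M) \<and> balance M v < 0. excess M f v (horizon M))"

definition can_send :: "('v, 'a) dnetwork \<Rightarrow> real \<Rightarrow> bool" where
  "can_send M x \<longleftrightarrow> (\<exists>f. flow_over_time M f \<and> x \<le> flow_value M f)"

text \<open>The arc \<open>(e, v, w)\<close> is the edge \<open>e\<close> traversed from \<open>v\<close> to \<open>w\<close>; each non-loop edge gives two
  arcs.\<close>

definition bidirection :: "('v, 'e) unetwork \<Rightarrow> ('v, 'e \<times> 'v \<times> 'v) dnetwork" where
  "bidirection N =
     \<lparr>graph = \<lparr>verts = nodes (graph N),
               arcs = {(e, v, w). e \<in> edges (graph N) \<and> ends (graph N) e = {v, w}},
               tail = (\<lambda>(e, v, w). v),
               head = (\<lambda>(e, v, w). w)\<rparr>,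
      capacity = (\<lambda>(e, v, w). capacity N e),
      balance = balance N,
      transit = (\<lambda>(e, v, w). transit N e),
      horizon = horizon N\<rparr>"

text \<open>The two directions of an edge share its capacity at every point in time.\<close>

definition undirected_flow_over_time ::
    "('v, 'e) unetwork \<Rightarrow> ('e \<times> 'v \<times> 'v \<Rightarrow> real \<Rightarrow> real) \<Rightarrow> bool" where
  "undirected_flow_over_time N f \<longleftrightarrow>
     flow_over_time (bidirection N) f \<and>
     (\<forall>e\<in>edges (graph N). \<forall>\<theta>\<in>{0..<horizon N}.
        (\<Sum>(v, w) | ends (graph N) e = {v, w}. f (e, v, w) \<theta>) \<le> capacity N e)"

definition can_send_undirected :: "('v, 'e) unetwork \<Rightarrow> real \<Rightarrow> bool" where
  "can_send_undirected N x \<longleftrightarrow>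
     (\<exists>f. undirected_flow_over_time N f \<and> x \<le> flow_value (bidirection N) f)"

definition orientation :: "('v, 'e) unetwork \<Rightarrow> ('v, 'e) dnetwork \<Rightarrow> bool" where
  "orientation N M \<longleftrightarrow>
     verts (graph M) = nodes (graph N) \<and>
     arcs (graph M) = edges (graph N) \<and>
     (\<forall>e\<in>edges (graph N). {tail (graph M) e, head (graph M) e} = ends (graph N) e) \<and>
     capacity M = capacity N \<and> balance M = balance N \<and>
     transit M = transit N \<and> horizon M = horizon N"

end

theory Submission
  imports Defs "Graph_Theory.Shortest_Path"
begin

text \<open>
  Give every edge a price \<open>y\<^sub>e\<close> and every terminal a delay \<open>L\<close>, and call the cost of a path the sum
  of its prices and transit times.  A fixed point argument yields prices, delays and a static flow on
  paths such that flow is only sent on paths whose cost and end delays add up to \<open>T\<close> (and none is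
  cheaper), a positive price means a saturated edge and a positive delay means a fully served terminal.
  Such a flow, repeated over time, never exceeds a balance.  It does not use an edge in both directions
  (exchanging tails would give a path that is too cheap, at least if each transit time is increased by some \<open>\<eta> > 0\<close>),
  so it lives in an orientation, and its value \<open>V\<close> is \<open>\<Sum> u\<^sub>e y\<^sub>e\<close>.  Terminals with positive delay contribute their
  whole balance to \<open>V\<close>.  For the other ones, the distances from the single source
  (or to the single sink) with respect to the costs define a cut over time of capacity
  \<open>\<Sum> u\<^sub>e y\<^sub>e = V\<close>, which bounds their balances by \<open>V\<close>.  Hence \<open>B \<le> 2 V\<close>, up to an error that vanishes with \<open>\<eta>\<close>;
  a compactness argument removes it.
\<close>

section \<open>Complementarity problems on a box\<close>

text \<open>Linear programming duality is not enough: a route of rate \<open>x\<close> sends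
  \<open>x\<close> times the sum of its prices, and the prices are unknowns too, so the bounds on
  supplies and demands are bilinear. The conditions therefore form a complementarity problem, solved
  on a box whose upper bounds do no harm when reached. A route sends for a period equal to its price
  sum, not for all the time its length leaves, so that counting by edges turns the value into the
  capacity of the cut. A single terminal matters for the cut: if it is delayed, its whole balance is
  already sent; if not, every undelayed terminal on the other side is at distance at least
  \<open>T\<close> from it, and the cut sees its full balance. Without \<open>\<eta>\<close>, an
  edge with zero transit time and zero price could be passed in both directions at no cost. As
  \<open>\<eta>\<close> vanishes, the ban on opposite use has to survive the limit, so it is
  expressed by equations between products of rates.\<close>

lemma compact_PiE_UNIV:
  fixes S :: "'i \<Rightarrow> 'a::topological_space set"
  assumes "\<And>i. compact (S i)"
  shows "compact (PiE UNIV S)"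
  using assms compactin_PiE[of "\<lambda>_. euclidean" UNIV S]
  by (simp add: euclidean_product_topology compactin_euclidean_iff)

lemma tendsto_fun_iff:
  fixes f :: "'b \<Rightarrow> 'i \<Rightarrow> 'a::topological_space"
  shows "(f \<longlongrightarrow> l) F \<longleftrightarrow> (\<forall>i. ((\<lambda>x. f x i) \<longlongrightarrow> l i) F)"
  using limitin_componentwise[of "\<lambda>_. euclidean" UNIV f l F]
  by (simp add: euclidean_product_topology)

text \<open>Kuhn's labelling lemma on finer and finer grids, with the signs of the components as
  labels: in some small cube every label takes both values, and by continuity a limit of these cubes
  is a zero.\<close>

lemma poincare_miranda:
  fixes F :: "(nat \<Rightarrow> real) \<Rightarrow> nat \<Rightarrow> real"
  assumes cont: "\<And>i. i < n \<Longrightarrow> continuous_on UNIV (\<lambda>z. F z i)"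
    and lower: "\<And>z i. i < n \<Longrightarrow> z i = 0 \<Longrightarrow> F z i \<le> 0"
    and upper: "\<And>z i. i < n \<Longrightarrow> z i = 1 \<Longrightarrow> F z i \<ge> 0"
  shows "\<exists>z. \<forall>i<n. z i \<in> {0..1} \<and> F z i = 0"
proof -
  define sc where "sc p x = (\<lambda>i. if i < n then real (x i) / real (Suc p) else 0)" for p and x :: "nat \<Rightarrow> nat"
  \<comment> \<open>The faces take precedence over the sign, because Kuhn's lemma prescribes their
    labels; a component that vanishes on the lower face would otherwise be labelled 1 there.\<close>
  define label where "label p x i =
    (if x i = 0 then 0 else if x i = Suc p then 1 else if F (sc p x) i \<ge> 0 then 1 else (0::nat))"
    for p x i
  have label1: "F (sc p x) i \<ge> 0" if "i < n" "label p x i = 1" for p x i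
    using that upper[of i "sc p x"] by (auto simp: label_def sc_def split: if_splits)
  have label0: "F (sc p x) i \<le> 0" if "i < n" "label p x i = 0" for p x i
    using that lower[of i "sc p x"] by (auto simp: label_def sc_def split: if_splits)
  have label01: "label p x i = 0 \<or> label p x i = 1" for p x i
    by (auto simp: label_def)
  have "\<exists>q. (\<forall>i<n. q i < Suc p) \<and> (\<forall>i<n. \<exists>r s.
      (\<forall>j<n. q j \<le> r j \<and> r j \<le> q j + 1) \<and> (\<forall>j<n. q j \<le> s j \<and> s j \<le> q j + 1) \<and>
      label p r i = 0 \<and> label p s i = 1)" for p
  proof (rule kuhn_lemma[of "Suc p" n "label p"])
    fix q assume q: "\<forall>i<n. q i < Suc p" and
      ex: "\<forall>i<n. \<exists>r s. (\<forall>j<n. q j \<le> r j \<and> r j \<le> q j + 1) \<and>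
        (\<forall>j<n. q j \<le> s j \<and> s j \<le> q j + 1) \<and> label p r i \<noteq> label p s i"
    show ?thesis
      by (rule exI[of _ q]) (use q ex label01 in metis)
  qed (auto simp: label_def)
  then obtain q where q: "\<And>p i. i < n \<Longrightarrow> q p i < Suc p"
    and ex: "\<And>p i. i < n \<Longrightarrow> \<exists>r s. (\<forall>j<n. q p j \<le> r j \<and> r j \<le> q p j + 1) \<and>
      (\<forall>j<n. q p j \<le> s j \<and> s j \<le> q p j + 1) \<and> label p r i = 0 \<and> label p s i = 1"
    by metis
  have "\<forall>i. \<exists>r s. i < n \<longrightarrow> (\<forall>p. (\<forall>j<n. q p j \<le> r p j \<and> r p j \<le> q p j + 1) \<and>
      (\<forall>j<n. q p j \<le> s p j \<and> s p j \<le> q p j + 1) \<and> label p (r p) i = 0 \<and> label p (s p) i = 1)"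
    using ex by metis
  then obtain r s where r: "\<And>i p j. i < n \<Longrightarrow> j < n \<Longrightarrow> q p j \<le> r i p j \<and> r i p j \<le> q p j + 1"
    and s: "\<And>i p j. i < n \<Longrightarrow> j < n \<Longrightarrow> q p j \<le> s i p j \<and> s i p j \<le> q p j + 1"
    and rs: "\<And>i p. i < n \<Longrightarrow> label p (r i p) i = 0" "\<And>i p. i < n \<Longrightarrow> label p (s i p) i = 1"
    by metis
  \<comment> \<open>Pinning the coordinates from \<open>n\<close> on to 0 puts all grid points into
    one compact set of functions.\<close>
  define K :: "(nat \<Rightarrow> real) set" where "K = PiE UNIV (\<lambda>i. if i < n then {0..1} else {0})"
  have "compact K"
    unfolding K_def by (rule compact_PiE_UNIV) auto
  moreover have "sc p (q p) \<in> K" for p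
  proof -
    have "real (q p i) / real (Suc p) \<le> 1" if "i < n" for i
      using q[OF that, of p] by (simp del: of_nat_Suc)
    moreover have "0 \<le> real (q p i) / real (Suc p)" for i by simp
    ultimately show ?thesis
      unfolding K_def sc_def by (intro PiE_I) (simp_all del: of_nat_Suc)
  qed
  ultimately obtain z \<sigma> where z: "z \<in> K" and \<sigma>: "strict_mono \<sigma>"
    and lim': "((\<lambda>m. sc m (q m)) \<circ> \<sigma>) \<longlonglongrightarrow> z"
    using seq_compactE[OF compact_imp_seq_compact] by metis
  have lim: "(\<lambda>m. sc (\<sigma> m) (q (\<sigma> m))) \<longlonglongrightarrow> z"
    using lim' by (simp add: comp_def)
  \<comment> \<open>The cubes shrink, so any choice of corners has the same limit, in particular the
    witnesses \<open>r\<close> and \<open>s\<close> of the two labels.\<close>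
  have near: "(\<lambda>m. sc (\<sigma> m) (w (\<sigma> m))) \<longlonglongrightarrow> z"
    if w: "\<And>p j. j < n \<Longrightarrow> q p j \<le> w p j \<and> w p j \<le> q p j + 1" for w
  proof (rule tendsto_fun_iff[THEN iffD2], rule allI)
    fix j
    have c: "(\<lambda>m. sc (\<sigma> m) (q (\<sigma> m)) j) \<longlonglongrightarrow> z j"
      using lim unfolding tendsto_fun_iff by blast
    have inv: "(\<lambda>m. 1 / real (Suc (\<sigma> m))) \<longlonglongrightarrow> 0"
      using LIMSEQ_subseq_LIMSEQ[OF lim_1_over_n[THEN LIMSEQ_Suc] \<sigma>] by (simp add: comp_def)
    have "(\<lambda>m. sc (\<sigma> m) (w (\<sigma> m)) j - sc (\<sigma> m) (q (\<sigma> m)) j) \<longlonglongrightarrow> 0"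
    proof (rule tendsto_sandwich[OF _ _ tendsto_const inv])
      show "\<forall>\<^sub>F m in sequentially. 0 \<le> sc (\<sigma> m) (w (\<sigma> m)) j - sc (\<sigma> m) (q (\<sigma> m)) j"
        using w[of j] by (auto simp: sc_def divide_right_mono)
      show "\<forall>\<^sub>F m in sequentially.
          sc (\<sigma> m) (w (\<sigma> m)) j - sc (\<sigma> m) (q (\<sigma> m)) j \<le> 1 / real (Suc (\<sigma> m))"
      proof (rule always_eventually, rule allI)
        fix m
        show "sc (\<sigma> m) (w (\<sigma> m)) j - sc (\<sigma> m) (q (\<sigma> m)) j \<le> 1 / real (Suc (\<sigma> m))"
        proof (cases "j < n")
          case True
          have "real (w (\<sigma> m) j) - real (q (\<sigma> m) j) \<le> 1"
            using w[OF True, of "\<sigma> m"] by linarith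
          then have "(real (w (\<sigma> m) j) - real (q (\<sigma> m) j)) / real (Suc (\<sigma> m)) \<le> 1 / real (Suc (\<sigma> m))"
            by (rule divide_right_mono) simp
          then show ?thesis using True by (simp add: sc_def diff_divide_distrib)
        qed (simp add: sc_def)
      qed
    qed
    from tendsto_add[OF c this] show "(\<lambda>m. sc (\<sigma> m) (w (\<sigma> m)) j) \<longlonglongrightarrow> z j"
      by simp
  qed
  have "F z i = 0" if i: "i < n" for i
  proof (rule antisym)
    have F: "isCont (\<lambda>z. F z i) z"
      using cont[OF i] by (simp add: continuous_on_eq_continuous_at)
    show "F z i \<le> 0"
      by (rule tendsto_upperbound[OF isCont_tendsto_compose[OF F near[OF r[OF i]]]])
         (use label0[OF i rs(1)[OF i]] in auto)
    show "0 \<le> F z i"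
      by (rule tendsto_lowerbound[OF isCont_tendsto_compose[OF F near[OF s[OF i]]]])
         (use label1[OF i rs(2)[OF i]] in auto)
  qed
  moreover have "z i \<in> {0..1}" if "i < n" for i
    using z that by (auto simp: K_def PiE_iff dest!: spec[of _ i])
  ultimately show ?thesis by blast
qed

text \<open>Each coordinate is stretched to the interval from -1 to 2 and clipped to the unit
  interval. The part clipped off tells at which bound the coordinate sits and fixes the sign of
  \<open>G\<close> there.\<close>

lemma box_complementarity:
  fixes G :: "('i \<Rightarrow> real) \<Rightarrow> 'i \<Rightarrow> real"
  assumes I: "finite I"
    and Y: "\<And>i. i \<in> I \<Longrightarrow> 0 \<le> Y i"
    and cont: "\<And>i. i \<in> I \<Longrightarrow> continuous_on UNIV (\<lambda>z. G z i)"
  obtains z where "\<And>i. i \<in> I \<Longrightarrow> 0 \<le> z i" "\<And>i. i \<in> I \<Longrightarrow> z i \<le> Y i"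
    "\<And>i. i \<in> I \<Longrightarrow> 0 < z i \<Longrightarrow> G z i \<le> 0" "\<And>i. i \<in> I \<Longrightarrow> z i < Y i \<Longrightarrow> 0 \<le> G z i"
proof -
  obtain h where h: "bij_betw h {..<card I} I"
    using ex_bij_betw_nat_finite[OF I] by (auto simp: atLeast0LessThan)
  define k where "k = the_inv_into {..<card I} h"
  have k: "k i < card I" "h (k i) = i" if "i \<in> I" for i
    using that h the_inv_into_into[of h "{..<card I}" i "{..<card I}"]
    by (auto simp: k_def bij_betw_def f_the_inv_into_f)
  have hI: "h j \<in> I" "k (h j) = j" if "j < card I" for j
    using that h by (auto simp: k_def bij_betw_def the_inv_into_f_f)
  define e where "e w i = 3 * w (k i) - (1::real)" for w and i
  define cl where "cl t = max 0 (min 1 t)" for t :: real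
  define z where "z w = (\<lambda>i. Y i * cl (e w i))" for w
  \<comment> \<open>The factor of \<open>G\<close> vanishes where the stretched coordinate is -1 or
    2, so the sign conditions on the faces hold whatever \<open>G\<close> is. At a zero of
    \<open>F\<close>, \<open>G\<close> is opposite in sign to the part clipped off, and 0 if nothing
    is.\<close>
  define F where "F w j = (1 - \<bar>e w (h j) - cl (e w (h j))\<bar>) * G (z w) (h j) + (e w (h j) - cl (e w (h j)))"
    for w j
  have "\<exists>w. \<forall>j<card I. w j \<in> {0..1} \<and> F w j = 0"
  proof (rule poincare_miranda)
    fix j assume j: "j < card I"
    have ce: "continuous_on UNIV (\<lambda>w. e w i)" for i
      unfolding e_def by (auto intro!: continuous_intros)
    have cz: "continuous_on UNIV z"
      unfolding z_def cl_def
      by (rule continuous_on_coordinatewise_then_product) (intro continuous_intros ce)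
    have "continuous_on UNIV (\<lambda>w. G (z w) (h j))"
      by (rule continuous_on_compose2[OF cont[OF hI(1)[OF j]] cz]) auto
    then show "continuous_on UNIV (\<lambda>w. F w j)"
      unfolding F_def cl_def by (intro continuous_intros ce)
  qed (auto simp: F_def e_def hI cl_def)
  then obtain w where w: "\<And>j. j < card I \<Longrightarrow> w j \<in> {0..1}" "\<And>j. j < card I \<Longrightarrow> F w j = 0"
    by blast
  have e: "-1 \<le> e w i" "e w i \<le> 2" if "i \<in> I" for i
    using w(1)[of "k i"] k[OF that] by (auto simp: e_def)
  have Fi: "(1 - \<bar>e w i - cl (e w i)\<bar>) * G (z w) i = cl (e w i) - e w i" if "i \<in> I" for i
    using w(2)[of "k i"] k[OF that] by (auto simp: F_def)
  show ?thesis
  proof (rule that[of "z w"])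
    fix i assume i: "i \<in> I"
    show "0 \<le> z w i" using Y[OF i] by (simp add: z_def cl_def)
    have "Y i * cl (e w i) \<le> Y i * 1"
      by (rule mult_left_mono) (use Y[OF i] in \<open>auto simp: cl_def\<close>)
    then show "z w i \<le> Y i" by (simp add: z_def)
    show "G (z w) i \<le> 0" if "0 < z w i"
    proof -
      have "0 < e w i" using that Y[OF i]
        by (cases "e w i \<le> 0") (auto simp: z_def cl_def)
      show ?thesis
      proof (cases "e w i \<le> 1")
        case True
        then show ?thesis using Fi[OF i] \<open>0 < e w i\<close> by (simp add: cl_def)
      next
        case False
        then have "(2 - e w i) * G (z w) i < 0" using Fi[OF i] by (simp add: cl_def abs_if algebra_simps)
        then show ?thesis using e[OF i] by (simp add: mult_less_0_iff)
      qed
    qed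
    show "0 \<le> G (z w) i" if "z w i < Y i"
    proof -
      have "e w i < 1" using that Y[OF i]
        by (cases "e w i \<ge> 1") (auto simp: z_def cl_def)
      show ?thesis
      proof (cases "e w i \<ge> 0")
        case True
        then show ?thesis using Fi[OF i] \<open>e w i < 1\<close> by (simp add: cl_def)
      next
        case False
        then have "(1 + e w i) * G (z w) i > 0" using Fi[OF i] by (simp add: cl_def abs_if algebra_simps)
        then show ?thesis using e[OF i] by (simp add: zero_less_mult_iff)
      qed
    qed
  qed
qed

section \<open>Flows over time that repeat static path flows\<close>

lemma emeasure_Ico: "emeasure lebesgue {a..<b::real} = ennreal (max 0 (b - a))"
  by (cases "a \<le> b") auto

lemma measure_Ico: "measure lebesgue {a..<b::real} = max 0 (b - a)"
  by (simp add: measure_def emeasure_Ico)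

text \<open>The amount that a pulse of rate 1 and length \<open>d\<close> has delivered at time
  \<open>z\<close> after its first arrival.\<close>

definition ramp :: "real \<Rightarrow> real \<Rightarrow> real" where
  "ramp d z = max 0 (min d z)"

text \<open>Inflow rate of a flow of rate 1 that enters a walk from time \<open>l\<close> on for a
  period \<open>d\<close> and never waits; several passages through one arc add up.\<close>

primrec pulse :: "('a \<Rightarrow> real) \<Rightarrow> real \<Rightarrow> real \<Rightarrow> 'a list \<Rightarrow> 'a \<Rightarrow> real \<Rightarrow> real" where
  "pulse \<tau> d l [] a t = 0"
| "pulse \<tau> d l (b # p) a t =
     (if a = b then indicator {l..<l + d} t else 0) + pulse \<tau> d (l + \<tau> b) p a t"

lemma pulse_nonneg: "0 \<le> pulse \<tau> d l p a t"
  by (induction p arbitrary: l) auto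

lemma pulse_le_count: "pulse \<tau> d l p a t \<le> real (count_list p a)"
proof (induction p arbitrary: l)
  case (Cons b p)
  show ?case using Cons[of "l + \<tau> b"] by (auto simp: indicator_def)
qed simp

text \<open>Whatever enters \<open>a\<close> has at least \<open>\<tau> a\<close> of its travel time
  left. This yields the requirement that nothing enters an arc too late to leave it before the
  horizon.\<close>

lemma pulse_eq_0:
  assumes "\<And>b. b \<in> set p \<Longrightarrow> 0 \<le> \<tau> b" "l + sum_list (map \<tau> p) + d - \<tau> a \<le> t"
  shows "pulse \<tau> d l p a t = 0"
  using assms
proof (induction p arbitrary: l)
  case (Cons b p)
  have "0 \<le> sum_list (map \<tau> p)"
    by (rule sum_list_nonneg) (use Cons.prems(1) in auto)
  moreover have "pulse \<tau> d (l + \<tau> b) p a t = 0"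
    by (rule Cons.IH) (use Cons.prems in auto)
  ultimately show ?case using Cons.prems(2) by auto
qed simp

lemma pulse_integrable: "set_integrable lebesgue {a..<b::real} (pulse \<tau> d l p e)"
proof (induction p arbitrary: l)
  case (Cons c p)
  have "set_integrable lebesgue {a..<b} (\<lambda>t. if e = c then indicator {l..<l + d} t else 0 :: real)"
  proof (cases "e = c")
    case True
    have "integrable lebesgue (indicator ({a..<b} \<inter> {l..<l + d}) :: real \<Rightarrow> real)"
      by (rule integrable_real_indicator) (auto simp: Int_atLeastLessThan emeasure_Ico)
    then show ?thesis
      using True unfolding set_integrable_def indicator_inter_arith by simp
  qed (simp add: set_integrable_def)
  from set_integral_add(1)[OF this Cons[of "l + \<tau> c"]] show ?case by simp
qed (simp add: set_integrable_def)

lemma integral_window: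
  assumes "0 \<le> l" "0 \<le> d"
  shows "(LINT t:{0..<z}|lebesgue. indicator {l..<l + d} t) = ramp d (z - l)"
proof -
  have "(LINT t:{0..<z}|lebesgue. indicator {l..<l + d} t :: real)
      = (LINT t|lebesgue. indicator ({0..<z} \<inter> {l..<l + d}) t)"
    unfolding set_lebesgue_integral_def indicator_inter_arith by simp
  also have "\<dots> = measure lebesgue ({0..<z} \<inter> {l..<l + d})"
    by (simp add: Int_atLeastLessThan)
  also have "\<dots> = measure lebesgue {l..<min z (l + d)}"
    using assms by (simp add: Int_atLeastLessThan)
  also have "\<dots> = ramp d (z - l)"
    using assms by (auto simp: ramp_def measure_Ico min_def)
  finally show ?thesis .
qed

lemma excess_start:
  assumes "\<And>a. a \<in> arcs (graph M) \<Longrightarrow> 0 \<le> transit M a"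
  shows "excess M f v 0 = 0"
  using assms by (simp add: excess_def in_arcs_def set_lebesgue_integral_def)

lemma excess_add:
  assumes "\<And>a b c. set_integrable lebesgue {b..<c::real} (f a)"
    and "\<And>a b c. set_integrable lebesgue {b..<c} (g a)"
  shows "excess M (\<lambda>a t. f a t + g a t) v \<theta> = excess M f v \<theta> + excess M g v \<theta>"
  unfolding excess_def by (simp add: set_integral_add(2)[OF assms] sum.distrib)

lemma excess_sum:
  assumes "\<And>i a b c. i \<in> I \<Longrightarrow> set_integrable lebesgue {b..<c::real} (f i a)"
  shows "excess M (\<lambda>a t. \<Sum>i\<in>I. x i * f i a t) v \<theta> = (\<Sum>i\<in>I. x i * excess M (f i) v \<theta>)"
proof -
  have "(LINT t:A|lebesgue. (\<Sum>i\<in>I. x i * f i a t)) = (\<Sum>i\<in>I. x i * (LINT t:A|lebesgue. f i a t))"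
    if "A = {b..<c}" for A b c a
    using assms[of _ b c a] that
    by (simp add: set_lebesgue_integral_def set_integrable_def sum_distrib_left mult.left_commute
        Bochner_Integration.integral_sum)
  then show ?thesis
    unfolding excess_def
    by (simp add: sum_distrib_left right_diff_distrib sum_subtractf sum.swap[of _ _ I])
qed

text \<open>Without waiting, what arrives at the head of an arc leaves along the next arc at the
  same moment. The contributions telescope, and only the two ends of the walk remain.\<close>

lemma excess_pulse:
  assumes fin: "finite (arcs (graph M))"
    and cas: "pre_digraph.cas (graph M) u p w" and p: "set p \<subseteq> arcs (graph M)"
    and nonneg: "\<And>a. a \<in> set p \<Longrightarrow> 0 \<le> transit M a" "0 \<le> l" "0 \<le> d"
  shows "excess M (pulse (transit M) d l p) v \<theta> =
    (if v = w then ramp d (\<theta> - l - sum_list (map (transit M) p)) else 0)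
    - (if v = u then ramp d (\<theta> - l) else 0)"
  using cas p nonneg
proof (induction p arbitrary: u l)
  case Nil
  then show ?case by (simp add: pre_digraph.cas.simps excess_def)
next
  case (Cons b p)
  let ?G = "graph M" and ?w = "\<lambda>a t. if a = b then indicator {l..<l + d} t else 0 :: real"
  have u: "u = tail ?G b" and cas: "pre_digraph.cas ?G (head ?G b) p w"
    using Cons.prems(1) by (auto simp: pre_digraph.cas.simps)
  have win: "set_integrable lebesgue {x..<y} (?w a)" for x y a
    using pulse_integrable[of x y "transit M" d l "[b]" a]
    unfolding pulse.simps[abs_def] by simp
  have zero: "(LINT t:A|lebesgue. if a = b then indicator {l..<l + d} t else 0 :: real)
      = (if a = b then (LINT t:A|lebesgue. indicator {l..<l + d} t) else 0)" for A a
    by simp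
  have b: "b \<in> arcs ?G" using Cons.prems by simp
  have 1: "excess M ?w v \<theta> = (if v = head ?G b then ramp d (\<theta> - l - transit M b) else 0)
      - (if v = tail ?G b then ramp d (\<theta> - l) else 0)"
    unfolding excess_def zero
    using b fin Cons.prems integral_window[of l d]
    by (simp add: sum.delta' in_arcs_def out_arcs_def algebra_simps cong: if_cong)
  have 2: "excess M (pulse (transit M) d (l + transit M b) p) v \<theta> =
    (if v = w then ramp d (\<theta> - (l + transit M b) - sum_list (map (transit M) p)) else 0)
    - (if v = head ?G b then ramp d (\<theta> - (l + transit M b)) else 0)"
    by (rule Cons.IH[OF cas]) (use Cons.prems in auto)
  have 3: "excess M (pulse (transit M) d l (b # p)) v \<theta>
      = excess M ?w v \<theta> + excess M (pulse (transit M) d (l + transit M b) p) v \<theta>"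
    unfolding excess_add[OF win pulse_integrable, symmetric] pulse.simps[abs_def] ..
  show ?case
    unfolding 3 1 2 by (simp add: u algebra_simps)
qed

type_synonym ('v, 'a) route = "'v \<times> 'a list \<times> 'v"

abbreviation start :: "('v, 'a) route \<Rightarrow> 'v" where "start P \<equiv> fst P"
abbreviation walk :: "('v, 'a) route \<Rightarrow> 'a list" where "walk P \<equiv> fst (snd P)"
abbreviation target :: "('v, 'a) route \<Rightarrow> 'v" where "target P \<equiv> snd (snd P)"

text \<open>The temporally repeated flow of Ford and Fulkerson: a route is fed from time 0 until the
  last moment from which its target is reached in time.\<close>

definition repeated :: "('v, 'a) dnetwork \<Rightarrow> ('v, 'a) route set \<Rightarrow> (('v, 'a) route \<Rightarrow> real) \<Rightarrow>
    'a \<Rightarrow> real \<Rightarrow> real" where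
  "repeated M R x a t =
     (\<Sum>P\<in>R. x P * pulse (transit M) (horizon M - sum_list (map (transit M) (walk P))) 0 (walk P) a t)"

locale repeated_routes =
  fixes M :: "('v, 'a) dnetwork" and R :: "('v, 'a) route set" and x :: "('v, 'a) route \<Rightarrow> real"
  assumes fin: "fin_digraph (graph M)" and fin_R: "finite R"
    and transit: "\<And>a. a \<in> arcs (graph M) \<Longrightarrow> 0 \<le> transit M a"
    and walk: "\<And>P. P \<in> R \<Longrightarrow> pre_digraph.awalk (graph M) (start P) (walk P) (target P)"
    and start: "\<And>P. P \<in> R \<Longrightarrow> 0 < balance M (start P)"
    and target: "\<And>P. P \<in> R \<Longrightarrow> balance M (target P) < 0"
    and x_nonneg: "\<And>P. P \<in> R \<Longrightarrow> 0 \<le> x P"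
    and time: "\<And>P. P \<in> R \<Longrightarrow> sum_list (map (transit M) (walk P)) \<le> horizon M"
    and capacity: "\<And>a. a \<in> arcs (graph M) \<Longrightarrow>
      (\<Sum>P\<in>R. x P * real (count_list (walk P) a)) \<le> capacity M a"
    and start_amount: "\<And>v. 0 < balance M v \<Longrightarrow>
      (\<Sum>P | P \<in> R \<and> start P = v. x P * (horizon M - sum_list (map (transit M) (walk P)))) \<le> balance M v"
    and target_amount: "\<And>v. balance M v < 0 \<Longrightarrow>
      (\<Sum>P | P \<in> R \<and> target P = v. x P * (horizon M - sum_list (map (transit M) (walk P)))) \<le> - balance M v"
begin

lemma repeated_nonneg: "0 \<le> repeated M R x a t"
  unfolding repeated_def by (intro sum_nonneg mult_nonneg_nonneg x_nonneg pulse_nonneg)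

lemma repeated_le_count: "repeated M R x a t \<le> (\<Sum>P\<in>R. x P * real (count_list (walk P) a))"
  unfolding repeated_def by (intro sum_mono mult_left_mono x_nonneg pulse_le_count)

abbreviation duration :: "('v, 'a) route \<Rightarrow> real" where
  "duration P \<equiv> horizon M - sum_list (map (transit M) (walk P))"

lemma walkD:
  assumes "P \<in> R"
  shows "start P \<in> verts (graph M)" "target P \<in> verts (graph M)" "set (walk P) \<subseteq> arcs (graph M)"
    "pre_digraph.cas (graph M) (start P) (walk P) (target P)"
proof -
  interpret fin_digraph "graph M" by (rule fin)
  note w = walk[OF assms]
  show "start P \<in> verts (graph M)" "target P \<in> verts (graph M)"
    using awalk_hd_in_verts[OF w] awalk_last_in_verts[OF w] .
  show "set (walk P) \<subseteq> arcs (graph M)" "cas (start P) (walk P) (target P)"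
    using w unfolding awalk_def by blast+
qed

lemma excess_repeated:
  "excess M (repeated M R x) v \<theta> =
     (\<Sum>P | P \<in> R \<and> target P = v. x P * ramp (duration P) (\<theta> - sum_list (map (transit M) (walk P))))
     - (\<Sum>P | P \<in> R \<and> start P = v. x P * ramp (duration P) \<theta>)"
proof -
  have "excess M (repeated M R x) v \<theta> =
      (\<Sum>P\<in>R. x P * excess M (pulse (transit M) (duration P) 0 (walk P)) v \<theta>)"
    unfolding repeated_def[abs_def] by (rule excess_sum) (rule pulse_integrable)
  also have "\<dots> = (\<Sum>P\<in>R. x P *
      ((if v = target P then ramp (duration P) (\<theta> - sum_list (map (transit M) (walk P))) else 0)
      - (if v = start P then ramp (duration P) \<theta> else 0)))"
  proof (rule sum.cong[OF refl])
    fix P assume P: "P \<in> R"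
    have "excess M (pulse (transit M) (duration P) 0 (walk P)) v \<theta> =
      (if v = target P then ramp (duration P) (\<theta> - 0 - sum_list (map (transit M) (walk P))) else 0)
      - (if v = start P then ramp (duration P) (\<theta> - 0) else 0)"
      by (rule excess_pulse)
        (use walkD[OF P] transit time[OF P] fin in \<open>auto simp: fin_digraph.finite_arcs\<close>)
    then show "x P * excess M (pulse (transit M) (duration P) 0 (walk P)) v \<theta> = x P *
      ((if v = target P then ramp (duration P) (\<theta> - sum_list (map (transit M) (walk P))) else 0)
      - (if v = start P then ramp (duration P) \<theta> else 0))" by simp
  qed
  also have "\<dots> = (\<Sum>P\<in>R. if target P = v then x P * ramp (duration P) (\<theta> - sum_list (map (transit M) (walk P))) else 0)
     - (\<Sum>P\<in>R. if start P = v then x P * ramp (duration P) \<theta> else 0)"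
    unfolding sum_subtractf[symmetric] by (rule sum.cong) (auto simp: algebra_simps)
  finally show ?thesis
    using fin_R by (simp add: sum.inter_filter)
qed

lemma ramp_bounds: "P \<in> R \<Longrightarrow> 0 \<le> ramp (duration P) z \<and> ramp (duration P) z \<le> duration P"
  using time[of P] by (simp add: ramp_def)

lemma sum_ramp_bounds:
  assumes "Q \<subseteq> R"
  shows "0 \<le> (\<Sum>P\<in>Q. x P * ramp (duration P) (z P))"
    "(\<Sum>P\<in>Q. x P * ramp (duration P) (z P)) \<le> (\<Sum>P\<in>Q. x P * duration P)"
  using assms ramp_bounds x_nonneg
  by (auto intro!: sum_nonneg mult_nonneg_nonneg sum_mono mult_left_mono)

text \<open>Nodes of balance 0 are neither start nor target of a route, so their excess is always 0.
  At a terminal, the amount sent or received so far is at most the final amount, which the locale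
  bounds by the balance.\<close>

lemma flow_over_time_repeated: "flow_over_time M (repeated M R x)"
  unfolding flow_over_time_def
proof (intro conjI ballI impI)
  fix a assume a: "a \<in> arcs (graph M)"
  show "repeated M R x a absolutely_integrable_on {0..<horizon M}"
    unfolding repeated_def[abs_def]
    unfolding set_integrable_def scaleR_sum_right
    by (intro Bochner_Integration.integrable_sum)
      (use set_integrable_mult_right[OF pulse_integrable] in \<open>simp add: set_integrable_def\<close>)
  fix \<theta>
  show "0 \<le> repeated M R x a \<theta>" by (rule repeated_nonneg)
  show "repeated M R x a \<theta> \<le> capacity M a"
    using repeated_le_count capacity[OF a] by (rule order_trans)
  assume \<theta>: "horizon M - transit M a \<le> \<theta>"
  have "pulse (transit M) (duration P) 0 (walk P) a \<theta> = 0" if P: "P \<in> R" for P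
  proof (rule pulse_eq_0)
    show "0 \<le> transit M b" if "b \<in> set (walk P)" for b
      using walkD(3)[OF P] that transit by blast
    show "0 + sum_list (map (transit M) (walk P)) + duration P - transit M a \<le> \<theta>"
      using \<theta> by simp
  qed
  then show "repeated M R x a \<theta> = 0"
    unfolding repeated_def by simp
next
  fix v assume v: "v \<in> verts (graph M)"
  have no_start: "{P. P \<in> R \<and> start P = v} = {}" if "balance M v \<le> 0"
    using that by (auto dest!: start)
  have no_target: "{P. P \<in> R \<and> target P = v} = {}" if "0 \<le> balance M v"
    using that by (auto dest!: target)
  note bounds = sum_ramp_bounds[of "{P. P \<in> R \<and> start P = v}", OF Collect_restrict]
    sum_ramp_bounds[of "{P. P \<in> R \<and> target P = v}", OF Collect_restrict]
  consider "balance M v = 0" | "0 < balance M v" | "balance M v < 0" by linarith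
  then show "conserves_at M (repeated M R x) v"
  proof cases
    case 1
    then show ?thesis
      by (simp only: conserves_at_def excess_repeated no_start no_target order_refl) simp
  next
    case 2
    then have "excess M (repeated M R x) v \<theta> =
        - (\<Sum>P | P \<in> R \<and> start P = v. x P * ramp (duration P) \<theta>)" for \<theta>
      by (simp only: excess_repeated no_target less_imp_le) simp
    then show ?thesis
      using 2 bounds(1) order_trans[OF bounds(2) start_amount[OF 2]]
      unfolding conserves_at_def by (simp only:) auto
  next
    case 3
    then have "excess M (repeated M R x) v \<theta> = (\<Sum>P | P \<in> R \<and> target P = v.
        x P * ramp (duration P) (\<theta> - sum_list (map (transit M) (walk P))))" for \<theta>
      by (simp only: excess_repeated no_start less_imp_le) simp
    then show ?thesis
      using 3 bounds(3) order_trans[OF bounds(4) target_amount[OF 3]]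
      unfolding conserves_at_def by (simp only:) auto
  qed
qed

lemma flow_value_repeated: "flow_value M (repeated M R x) = (\<Sum>P\<in>R. x P * duration P)"
proof -
  let ?S = "{v \<in> verts (graph M). balance M v < 0}"
  have no_start: "{P. P \<in> R \<and> start P = v} = {}" if "balance M v < 0" for v
    using that by (auto dest!: start)
  have "flow_value M (repeated M R x) = (\<Sum>v\<in>?S. \<Sum>P | P \<in> R \<and> target P = v. x P * duration P)"
    unfolding flow_value_def excess_repeated
  proof (intro sum.cong refl)
    fix v assume "v \<in> ?S"
    then have "(\<Sum>P | P \<in> R \<and> start P = v. x P * ramp (duration P) (horizon M)) = 0"
      by (simp only: mem_Collect_eq no_start sum.empty)
    moreover have "ramp (duration P) (duration P) = duration P" if "P \<in> R" for P
      using time[OF that] by (simp add: ramp_def)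
    ultimately show "(\<Sum>P | P \<in> R \<and> target P = v. x P * ramp (duration P) (duration P))
        - (\<Sum>P | P \<in> R \<and> start P = v. x P * ramp (duration P) (horizon M))
      = (\<Sum>P | P \<in> R \<and> target P = v. x P * duration P)" by simp
  qed
  also have "\<dots> = (\<Sum>P\<in>R. x P * duration P)"
    by (rule sum.group) (use fin walkD(2) target fin_R in \<open>auto simp: fin_digraph.finite_verts\<close>)
  finally show ?thesis .
qed

end

section \<open>Cuts over time\<close>

lemma integral_diff_le:
  fixes g :: "real \<Rightarrow> real"
  assumes g: "set_integrable lebesgue {0..<T} g" and b: "b \<le> T" and a: "0 \<le> a" "a \<le> T"
    and bounds: "\<And>t. t \<in> {0..<T} \<Longrightarrow> 0 \<le> g t \<and> g t \<le> u"
  shows "(LINT t:{0..<b}|lebesgue. g t) - (LINT t:{0..<a}|lebesgue. g t) \<le> u * max 0 (b - a)"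
proof -
  have int: "set_integrable lebesgue {c..<d} g" if "0 \<le> c" "d \<le> T" for c d
    by (rule set_integrable_subset[OF g]) (use that in auto)
  show ?thesis
  proof (cases "b \<le> a")
    case True
    \<comment> \<open>Since \<open>b\<close> may be negative, the initial interval has to be cut at
      \<open>max 0 b\<close>.\<close>
    have "(LINT t:{0..<max 0 b} \<union> {max 0 b..<a}|lebesgue. g t) =
        (LINT t:{0..<max 0 b}|lebesgue. g t) + (LINT t:{max 0 b..<a}|lebesgue. g t)"
      by (rule set_integral_Un) (use a b in \<open>auto intro!: int\<close>)
    moreover have "{0..<max 0 b} \<union> {max 0 b..<a} = {0..<a}" "{0..<max 0 b} = {0..<b}"
      using True a by auto
    moreover have "0 \<le> (LINT t:{max 0 b..<a}|lebesgue. g t)"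
      unfolding set_lebesgue_integral_def
      by (rule Bochner_Integration.integral_nonneg) (use bounds a in \<open>auto simp: indicator_def\<close>)
    ultimately show ?thesis using True by simp
  next
    case False
    have "(LINT t:{0..<a} \<union> {a..<b}|lebesgue. g t) =
        (LINT t:{0..<a}|lebesgue. g t) + (LINT t:{a..<b}|lebesgue. g t)"
      by (rule set_integral_Un) (use a b in \<open>auto intro!: int\<close>)
    moreover have "{0..<a} \<union> {a..<b} = {0..<b}"
      using False a by auto
    moreover have "(LINT t:{a..<b}|lebesgue. g t) \<le> (LINT t:{a..<b}|lebesgue. u)"
      by (rule set_integral_mono[OF int])
        (use bounds a b in \<open>auto simp: set_integrable_def emeasure_Ico\<close>)
    moreover have "(LINT t:{a..<b}|lebesgue. u) = u * (b - a)"
      using False by (simp add: set_lebesgue_integral_def measure_Ico)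
    ultimately show ?thesis using False by simp
  qed
qed

text \<open>Weak duality: node \<open>v\<close> is looked at at time \<open>h v\<close>. In the sum,
  an arc counts what entered it early enough to reach its head in time, less what entered before the
  time of its tail; only inflow between these two moments can contribute.\<close>

lemma excess_cut:
  assumes "fin_digraph (graph M)" and f: "flow_over_time M f"
    and transit: "\<And>a. a \<in> arcs (graph M) \<Longrightarrow> 0 \<le> transit M a"
    and h: "\<And>v. v \<in> verts (graph M) \<Longrightarrow> h v \<in> {0..horizon M}"
  shows "(\<Sum>v\<in>verts (graph M). excess M f v (h v)) \<le>
    (\<Sum>a\<in>arcs (graph M). capacity M a *
       max 0 (h (head (graph M) a) - transit M a - h (tail (graph M) a)))"
proof -
  interpret fin_digraph "graph M" by fact
  let ?G = "graph M"
  have "(\<Sum>v\<in>verts ?G. excess M f v (h v)) =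
      (\<Sum>v\<in>verts ?G. \<Sum>a | a \<in> arcs ?G \<and> head ?G a = v.
          LINT t:{0..<h (head ?G a) - transit M a}|lebesgue. f a t)
    - (\<Sum>v\<in>verts ?G. \<Sum>a | a \<in> arcs ?G \<and> tail ?G a = v. LINT t:{0..<h (tail ?G a)}|lebesgue. f a t)"
    unfolding excess_def sum_subtractf in_arcs_def out_arcs_def by simp
  also have "\<dots> = (\<Sum>a\<in>arcs ?G. LINT t:{0..<h (head ?G a) - transit M a}|lebesgue. f a t)
     - (\<Sum>a\<in>arcs ?G. LINT t:{0..<h (tail ?G a)}|lebesgue. f a t)"
    by (intro arg_cong2[where f = minus] sum.group) auto
  also have "\<dots> \<le> (\<Sum>a\<in>arcs ?G. capacity M a * max 0 (h (head ?G a) - transit M a - h (tail ?G a)))"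
    unfolding sum_subtractf[symmetric]
  proof (rule sum_mono)
    fix a assume a: "a \<in> arcs ?G"
    show "(LINT t:{0..<h (head ?G a) - transit M a}|lebesgue. f a t)
        - (LINT t:{0..<h (tail ?G a)}|lebesgue. f a t)
      \<le> capacity M a * max 0 (h (head ?G a) - transit M a - h (tail ?G a))"
      by (rule integral_diff_le[where T = "horizon M"])
        (use a f h[of "head ?G a"] h[of "tail ?G a"] transit[OF a] in \<open>auto simp: flow_over_time_def\<close>)
  qed
  finally show ?thesis .
qed

section \<open>Prices and delays\<close>

lemma continuous_on_sum_list:
  fixes f :: "'a::topological_space \<Rightarrow> 'b \<Rightarrow> real"
  assumes "\<And>e. e \<in> set es \<Longrightarrow> continuous_on S (\<lambda>z. f z e)"
  shows "continuous_on S (\<lambda>z. sum_list (map (f z) es))"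
  using assms by (induction es) (auto intro!: continuous_intros)

text \<open>Complementarity between rates \<open>x\<close>, prices \<open>y\<close> of edges and delays \<open>L\<close> of terminals: an edge
  has a price only if it is saturated, a terminal is delayed only if its demand is met, and only
  cheapest routes are used.  A used route of price \<open>y\<close> sends for a period of length \<open>y\<close>.\<close>

lemma path_price_equilibrium:
  fixes es :: "'p \<Rightarrow> 'e list" and s t :: "'p \<Rightarrow> 'k"
  assumes fin: "finite R" "finite E" "finite K"
    and es: "\<And>P. P \<in> R \<Longrightarrow> set (es P) \<subseteq> E" "\<And>P. P \<in> R \<Longrightarrow> es P \<noteq> []"
    and st: "\<And>P. P \<in> R \<Longrightarrow> s P \<in> K" "\<And>P. P \<in> R \<Longrightarrow> t P \<in> K"
    and u: "\<And>e. e \<in> E \<Longrightarrow> 0 \<le> u e" and c: "\<And>e. e \<in> E \<Longrightarrow> 0 \<le> c e"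
    and d: "\<And>k. k \<in> K \<Longrightarrow> 0 < d k" and T: "0 \<le> T"
  obtains x :: "'p \<Rightarrow> real" and y :: "'e \<Rightarrow> real" and L :: "'k \<Rightarrow> real"
  where "\<And>P. P \<in> R \<Longrightarrow> 0 \<le> x P" "\<And>e. e \<in> E \<Longrightarrow> 0 \<le> y e" "\<And>k. k \<in> K \<Longrightarrow> 0 \<le> L k"
    and "\<And>P. P \<in> R \<Longrightarrow> T \<le> (\<Sum>e\<leftarrow>es P. y e + c e) + L (s P) + L (t P)"
    and "\<And>P. P \<in> R \<Longrightarrow> 0 < x P \<Longrightarrow> (\<Sum>e\<leftarrow>es P. y e + c e) + L (s P) + L (t P) \<le> T"
    and "\<And>e. e \<in> E \<Longrightarrow> (\<Sum>P\<in>R. x P * real (count_list (es P) e)) \<le> u e"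
    and "\<And>e. e \<in> E \<Longrightarrow> 0 < y e \<Longrightarrow> u e \<le> (\<Sum>P\<in>R. x P * real (count_list (es P) e))"
    and "\<And>k. k \<in> K \<Longrightarrow> (\<Sum>P | P \<in> R \<and> (s P = k \<or> t P = k). x P * (\<Sum>e\<leftarrow>es P. y e)) \<le> d k"
    and "\<And>k. k \<in> K \<Longrightarrow> 0 < L k \<Longrightarrow>
      d k \<le> (\<Sum>P | P \<in> R \<and> (s P = k \<or> t P = k). x P * (\<Sum>e\<leftarrow>es P. y e))"
proof -
  define I where "I = Inl ` R \<union> Inr ` (Inl ` E \<union> Inr ` K)"
  define U where "U = 1 + sum u E"
  define Y where "Y i = (case i of Inl P \<Rightarrow> U | Inr j \<Rightarrow> T + 1)" for i :: "'p + 'e + 'k"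
  define X where "X z P = z (Inl P)" for z :: "'p + 'e + 'k \<Rightarrow> real" and P
  define y where "y z e = z (Inr (Inl e))" for z :: "'p + 'e + 'k \<Rightarrow> real" and e
  define L where "L z k = z (Inr (Inr k))" for z :: "'p + 'e + 'k \<Rightarrow> real" and k
  define GP where "GP z P = (\<Sum>e\<leftarrow>es P. y z e + c e) + L z (s P) + L z (t P) - T" for z P
  define GE where "GE z e = u e - (\<Sum>P\<in>R. X z P * real (count_list (es P) e))" for z e
  define GK where "GK z k = d k - (\<Sum>P | P \<in> R \<and> (s P = k \<or> t P = k). X z P * (\<Sum>e\<leftarrow>es P. y z e))"
    for z k
  define G where "G z i = (case i of Inl P \<Rightarrow> GP z P | Inr (Inl e) \<Rightarrow> GE z e | Inr (Inr k) \<Rightarrow> GK z k)"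
    for z i
  have U: "0 < U" "\<And>e. e \<in> E \<Longrightarrow> u e < U"
    using member_le_sum[of _ E u] u fin sum_nonneg[of E u] by (fastforce simp: U_def)+
  have cont: "continuous_on UNIV (\<lambda>z. G z i)" for i
    unfolding G_def GP_def GE_def GK_def X_def y_def L_def
    by (cases i; cases "projr i") (auto intro!: continuous_intros continuous_on_sum_list)
  obtain z where z0: "\<And>i. i \<in> I \<Longrightarrow> 0 \<le> z i" and zY: "\<And>i. i \<in> I \<Longrightarrow> z i \<le> Y i"
    and neg: "\<And>i. i \<in> I \<Longrightarrow> 0 < z i \<Longrightarrow> G z i \<le> 0"
    and pos: "\<And>i. i \<in> I \<Longrightarrow> z i < Y i \<Longrightarrow> 0 \<le> G z i"
  proof (rule box_complementarity[of I Y G])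
    show "finite I" using fin by (simp add: I_def)
    show "0 \<le> Y i" for i using U(1) T by (simp add: Y_def split: sum.split)
    show "continuous_on UNIV (\<lambda>z. G z i)" for i by (rule cont)
  qed blast
  have x0: "0 \<le> X z P" if "P \<in> R" for P
    using z0[of "Inl P"] that by (simp add: I_def X_def)
  have y0: "0 \<le> y z e" if "e \<in> E" for e
    using z0[of "Inr (Inl e)"] that by (simp add: I_def y_def)
  have L0: "0 \<le> L z k" if "k \<in> K" for k
    using z0[of "Inr (Inr k)"] that by (simp add: I_def L_def)
  have tight: "GP z P \<le> 0" if "P \<in> R" "0 < X z P" for P
    using neg[of "Inl P"] that by (simp add: I_def X_def G_def)
  have satE: "GE z e \<le> 0" if "e \<in> E" "0 < y z e" for e
    using neg[of "Inr (Inl e)"] that by (simp add: I_def y_def G_def)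
  have satK: "GK z k \<le> 0" if "k \<in> K" "0 < L z k" for k
    using neg[of "Inr (Inr k)"] that by (simp add: I_def L_def G_def)
  have mem: "y z e \<le> (\<Sum>e\<leftarrow>es P. y z e + c e)" if "P \<in> R" "e \<in> set (es P)" for P e
  proof -
    have "y z e + c e \<le> (\<Sum>e\<leftarrow>es P. y z e + c e)"
      using es(1)[OF that(1)] that(2) y0 c
      by (intro member_le_sum_list) (auto intro!: add_nonneg_nonneg)
    then show ?thesis using c[of e] es(1)[OF that(1)] that(2) by fastforce
  qed
  have cost0: "0 \<le> (\<Sum>e\<leftarrow>es P. y z e + c e)" if "P \<in> R" for P
    using es(1)[OF that] y0 c by (intro sum_list_nonneg) (auto intro!: add_nonneg_nonneg)
  \<comment> \<open>Complementarity gives this below the upper bound for prices; at the bound, no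
    used route contains the edge and its load is 0. The proof of \<open>slack\<close> relies on it
    to keep rates away from \<open>U\<close>.\<close>
  have usage: "GE z e \<ge> 0" if e: "e \<in> E" for e
  proof (cases "y z e < T + 1")
    case True
    then show ?thesis
      using pos[of "Inr (Inl e)"] e by (simp add: I_def y_def G_def Y_def)
  next
    case False
    have "X z P * real (count_list (es P) e) = 0" if P: "P \<in> R" for P
    proof (cases "e \<in> set (es P)")
      case True
      then have "GP z P > 0"
        using mem[OF P True] L0[OF st(1)[OF P]] L0[OF st(2)[OF P]] False by (simp add: GP_def)
      then show ?thesis using tight[OF P] x0[OF P] by force
    qed (simp add: count_list_0_iff)
    then have "(\<Sum>P\<in>R. X z P * real (count_list (es P) e)) = 0"
      by (intro sum.neutral) blast
    then show ?thesis using u[OF e] by (simp add: GE_def)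
  qed
  have slack: "GP z P \<ge> 0" if P: "P \<in> R" for P
  proof (rule ccontr)
    assume *: "\<not> GP z P \<ge> 0"
    then have x: "X z P \<ge> U"
      using pos[of "Inl P"] P by (force simp: I_def X_def G_def Y_def)
    obtain e where e: "e \<in> set (es P)" using es(2)[OF P] by (meson last_in_set)
    then have eE: "e \<in> E" using es(1)[OF P] by auto
    have "1 \<le> real (count_list (es P) e)"
      using e count_list_0_iff[of "es P" e] by linarith
    then have "U * 1 \<le> X z P * real (count_list (es P) e)"
      by (intro mult_mono x) (use U x in auto)
    also have "\<dots> \<le> (\<Sum>P\<in>R. X z P * real (count_list (es P) e))"
      using P x0 fin by (intro member_le_sum) auto
    also have "\<dots> \<le> u e" using usage[OF eE] by (simp add: GE_def)
    finally show False using U(2)[OF eE] by simp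
  qed
  have amount: "GK z k \<ge> 0" if k: "k \<in> K" for k
  proof (cases "L z k < T + 1")
    case True
    then show ?thesis
      using pos[of "Inr (Inr k)"] k by (simp add: I_def L_def G_def Y_def)
  next
    case False
    have "X z P = 0" if P: "P \<in> R" "s P = k \<or> t P = k" for P
    proof -
      have "GP z P > 0"
        using L0[OF st(1)[OF P(1)]] L0[OF st(2)[OF P(1)]] False P(2) cost0[OF P(1)]
        by (auto simp: GP_def)
      then show ?thesis using tight[OF P(1)] x0[OF P(1)] by force
    qed
    then show ?thesis using d[OF k] by (simp add: GK_def)
  qed
  show thesis
    by (rule that[of "X z" "y z" "L z"])
      (use x0 y0 L0 tight satE satK usage slack amount in \<open>simp_all add: GP_def GE_def GK_def\<close>)
qed

section \<open>Distances\<close>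

context fin_digraph
begin

text \<open>Simple paths are finite in number, so the minimum exists. For nonnegative costs it is
  the distance over all walks, cut off at \<open>T\<close>, which is also the value at unreachable
  nodes; this keeps cut times within the horizon.\<close>

definition capped_dist :: "real \<Rightarrow> ('b \<Rightarrow> real) \<Rightarrow> 'a \<Rightarrow> 'a \<Rightarrow> real" where
  "capped_dist T f u v = Min (insert T (awalk_cost f ` {p. apath u p v}))"

lemma awalk_to_apath_cost_le:
  assumes "awalk u p v" "\<And>a. a \<in> arcs G \<Longrightarrow> 0 \<le> f a"
  shows "awalk_cost f (awalk_to_apath p) \<le> awalk_cost f p"
proof (rule awalk_to_path_no_neg_cyc_cost[OF assms(1)])
  have "0 \<le> awalk_cost f c" if "awalk w c w" for w c
    unfolding awalk_cost_def
    by (rule sum_list_nonneg) (use that assms(2) in \<open>auto simp: awalk_def\<close>)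
  then show "\<not> (\<exists>w c. awalk w c w \<and> w \<in> set (awalk_verts u p) \<and> awalk_cost f c < 0)"
    by (auto simp: not_less)
qed

lemma capped_dist_le: "capped_dist T f u v \<le> T"
  unfolding capped_dist_def by (rule Min_le) (simp_all add: apaths_finite)

lemma capped_dist_le_awalk:
  assumes "awalk u p v" "\<And>a. a \<in> arcs G \<Longrightarrow> 0 \<le> f a"
  shows "capped_dist T f u v \<le> awalk_cost f p"
proof -
  have "capped_dist T f u v \<le> awalk_cost f (awalk_to_apath p)"
    unfolding capped_dist_def
    by (rule Min_le) (auto simp: apaths_finite intro!: imageI apath_awalk_to_apath[OF assms(1)])
  also note awalk_to_apath_cost_le[OF assms]
  finally show ?thesis .
qed

lemma capped_dist_cases:
  obtains "capped_dist T f u v = T" | p where "apath u p v" "capped_dist T f u v = awalk_cost f p"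
proof -
  have "capped_dist T f u v \<in> insert T (awalk_cost f ` {p. apath u p v})"
    unfolding capped_dist_def by (rule Min_in) (simp_all add: apaths_finite)
  then show ?thesis using that by blast
qed

lemma capped_dist_nonneg:
  assumes "0 \<le> T" "\<And>a. a \<in> arcs G \<Longrightarrow> 0 \<le> f a"
  shows "0 \<le> capped_dist T f u v"
proof (cases rule: capped_dist_cases[of T f u v])
  case (2 p)
  then have "awalk u p v" by (simp add: apath_def)
  then have "0 \<le> awalk_cost f p"
    unfolding awalk_cost_def using assms(2) by (intro sum_list_nonneg) (auto simp: awalk_def)
  then show ?thesis using 2 by simp
qed (use assms in simp)

lemma capped_dist_self:
  assumes "0 \<le> T" "\<And>a. a \<in> arcs G \<Longrightarrow> 0 \<le> f a" "u \<in> verts G"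
  shows "capped_dist T f u u = 0"
proof (rule antisym)
  show "capped_dist T f u u \<le> 0"
    using capped_dist_le_awalk[of u "[]" u f T] assms by (simp add: awalk_Nil_iff)
qed (rule capped_dist_nonneg[OF assms(1,2)])

lemma capped_dist_eq_cap:
  assumes "\<And>p. apath u p v \<Longrightarrow> T \<le> awalk_cost f p"
  shows "capped_dist T f u v = T"
  using capped_dist_le[of T f u v] assms by (cases rule: capped_dist_cases[of T f u v]) force+

text \<open>The triangle inequality, in the form that makes distances usable as cut times: an arc
  can be crossed only for as long as its cost exceeds its transit time. The next lemma is the mirror
  image, for distances to a fixed node.\<close>

lemma capped_dist_head_le:
  assumes a: "a \<in> arcs G" and f: "\<And>a. a \<in> arcs G \<Longrightarrow> 0 \<le> f a"
  shows "capped_dist T f u (head G a) \<le> capped_dist T f u (tail G a) + f a"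
proof (cases rule: capped_dist_cases[of T f u "tail G a"])
  case 1
  then show ?thesis using capped_dist_le[of T f u "head G a"] f[OF a] by simp
next
  case (2 p)
  then have "awalk u (p @ [a]) (head G a)"
    using a by (auto simp: apath_def awalk_simps)
  from capped_dist_le_awalk[OF this f] show ?thesis using 2 by simp
qed

lemma capped_dist_tail_le:
  assumes a: "a \<in> arcs G" and f: "\<And>a. a \<in> arcs G \<Longrightarrow> 0 \<le> f a"
  shows "capped_dist T f (tail G a) v \<le> f a + capped_dist T f (head G a) v"
proof (cases rule: capped_dist_cases[of T f "head G a" v])
  case 1
  then show ?thesis using capped_dist_le[of T f "tail G a" v] f[OF a] by simp
next
  case (2 p)
  then have "awalk (tail G a) (a # p) v"
    using a by (auto simp: apath_def awalk_simps)
  from capped_dist_le_awalk[OF this f] show ?thesis using 2 by simp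
qed

end

section \<open>Path flows in undirected networks\<close>

lemma bidirection_simps [simp]:
  "verts (graph (bidirection N)) = nodes (graph N)"
  "a \<in> arcs (graph (bidirection N)) \<longleftrightarrow> fst a \<in> edges (graph N) \<and> ends (graph N) (fst a) = {fst (snd a), snd (snd a)}"
  "tail (graph (bidirection N)) a = fst (snd a)" "head (graph (bidirection N)) a = snd (snd a)"
  "capacity (bidirection N) a = capacity N (fst a)"
  "transit (bidirection N) a = transit N (fst a)"
  "balance (bidirection N) = balance N" "horizon (bidirection N) = horizon N"
  by (auto simp: bidirection_def split: prod.splits)

context undirected_network
begin

abbreviation bi :: "('v, 'e \<times> 'v \<times> 'v) pre_digraph" where
  "bi \<equiv> graph (bidirection N)"

lemma arcs_bidirection:
  "arcs bi = (SIGMA e:edges (graph N). {(v, w). ends (graph N) e = {v, w}})"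
  by (auto simp: bidirection_def)

text \<open>Covers loops: then \<open>p = q\<close>, and the two directions are one.\<close>

lemma edge_directions:
  assumes "e \<in> edges (graph N)"
  obtains p q where "ends (graph N) e = {p, q}" "p \<in> nodes (graph N)" "q \<in> nodes (graph N)"
    "{(v, w). ends (graph N) e = {v, w}} = {(p, q), (q, p)}"
  using ends[OF assms] by (auto simp: doubleton_eq_iff)

lemma fin_digraph_bidirection: "fin_digraph bi"
proof
  show "tail bi a \<in> verts bi" "head bi a \<in> verts bi" if "a \<in> arcs bi" for a
    using that ends[of "fst a"] by (auto simp: doubleton_eq_iff)
  have "finite {(v, w). ends (graph N) e = {v, w}}" if "e \<in> edges (graph N)" for e
    by (rule edge_directions[OF that]) simp
  then show "finite (arcs bi)"
    unfolding arcs_bidirection using finite_edges by blast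
qed (simp add: finite_nodes)

sublocale bi: fin_digraph bi
  by (rule fin_digraph_bidirection)

text \<open>Both directions of an edge cannot be crossed by the cut at the same time, so the bound does not
  even need that they share the capacity.\<close>

lemma excess_cut_undirected:
  assumes f: "flow_over_time (bidirection N) f"
    and h: "\<And>v. v \<in> nodes (graph N) \<Longrightarrow> h v \<in> {0..horizon N}"
    and k: "\<And>e. e \<in> edges (graph N) \<Longrightarrow> 0 \<le> k e"
      "\<And>a. a \<in> arcs bi \<Longrightarrow> h (head bi a) \<le> h (tail bi a) + transit N (fst a) + k (fst a)"
  shows "(\<Sum>v\<in>nodes (graph N). excess (bidirection N) f v (h v)) \<le>
    (\<Sum>e\<in>edges (graph N). capacity N e * k e)"
proof -
  let ?D = "\<lambda>e. {(v, w). ends (graph N) e = {v, w}}"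
  let ?g = "\<lambda>e d. capacity N e * max 0 (h (snd d) - transit N e - h (fst d))"
  have "(\<Sum>v\<in>nodes (graph N). excess (bidirection N) f v (h v)) \<le> (\<Sum>a\<in>arcs bi. ?g (fst a) (snd a))"
    using excess_cut[OF fin_digraph_bidirection f, of h] transit_nonneg h by simp
  also have "\<dots> = (\<Sum>e\<in>edges (graph N). \<Sum>d\<in>?D e. ?g e d)"
    unfolding arcs_bidirection
    by (subst sum.Sigma) (auto simp: finite_edges case_prod_unfold elim!: edge_directions)
  also have "\<dots> \<le> (\<Sum>e\<in>edges (graph N). capacity N e * k e)"
  proof (rule sum_mono)
    fix e assume e: "e \<in> edges (graph N)"
    obtain p q where pq: "ends (graph N) e = {p, q}" "?D e = {(p, q), (q, p)}"
      by (rule edge_directions[OF e])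
    have le: "h q \<le> h p + transit N e + k e" "h p \<le> h q + transit N e + k e"
      using k(2)[of "(e, p, q)"] k(2)[of "(e, q, p)"] e pq(1) by (auto simp: insert_commute)
    have "(\<Sum>d\<in>?D e. ?g e d) \<le> ?g e (p, q) + ?g e (q, p)"
      unfolding pq(2) using capacity_nonneg[OF e] by (cases "p = q") auto
    also have "\<dots> = capacity N e *
        (max 0 (h q - transit N e - h p) + max 0 (h p - transit N e - h q))"
      by (simp add: distrib_left)
    also have "\<dots> \<le> capacity N e * k e"
      using le k(1)[OF e] transit_nonneg[OF e] capacity_nonneg[OF e]
      by (intro mult_left_mono) (auto simp: max_def)
    finally show "(\<Sum>d\<in>?D e. ?g e d) \<le> capacity N e * k e" .
  qed
  finally show ?thesis .
qed

section \<open>Routes and the compact set of admissible rates\<close>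

definition routes :: "('v, 'e \<times> 'v \<times> 'v) route set" where
  "routes = {P. start P \<in> sources N \<and> target P \<in> sinks N \<and> bi.apath (start P) (walk P) (target P)}"

definition route_edges :: "('v, 'e \<times> 'v \<times> 'v) route \<Rightarrow> 'e list" where
  "route_edges P = map fst (walk P)"

abbreviation travel :: "('v, 'e \<times> 'v \<times> 'v) route \<Rightarrow> real" where
  "travel P \<equiv> (\<Sum>e\<leftarrow>route_edges P. transit N e)"

lemma finite_routes: "finite routes"
proof (rule finite_subset)
  show "routes \<subseteq> {(u, p, v). bi.apath u p v}" by (auto simp: routes_def)
qed (rule bi.apaths_finite_triple)

lemma finite_terminals: "finite (sources N)" "finite (sinks N)"
  using finite_nodes by (auto simp: sources_def sinks_def)

lemma disjoint_terminals: "sources N \<inter> sinks N = {}"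
  by (auto simp: sources_def sinks_def)

lemma route_props:
  assumes "P \<in> routes"
  shows "start P \<in> sources N" "target P \<in> sinks N" "bi.awalk (start P) (walk P) (target P)"
    "set (route_edges P) \<subseteq> edges (graph N)" "route_edges P \<noteq> []"
proof -
  show *: "start P \<in> sources N" "target P \<in> sinks N" "bi.awalk (start P) (walk P) (target P)"
    using assms by (auto simp: routes_def bi.apath_def)
  show "set (route_edges P) \<subseteq> edges (graph N)"
    using *(3) by (auto simp: route_edges_def bi.awalk_def)
  show "route_edges P \<noteq> []"
    using * disjoint_terminals by (auto simp: route_edges_def bi.awalk_Nil_iff)
qed

lemma sum_terminals:
  "(\<Sum>k\<in>sources N. balance N k) = total_supply N" "(\<Sum>k\<in>sinks N. - balance N k) = total_supply N"
proof -
  show "(\<Sum>k\<in>sources N. balance N k) = total_supply N" by (simp add: total_supply_def)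
  have "(\<Sum>k\<in>nodes (graph N). balance N k) = (\<Sum>k\<in>sources N \<union> sinks N. balance N k)"
    by (rule sum.mono_neutral_right) (auto simp: finite_nodes sources_def sinks_def)
  also have "\<dots> = total_supply N + (\<Sum>k\<in>sinks N. balance N k)"
    using finite_terminals disjoint_terminals by (simp add: sum.union_disjoint total_supply_def)
  finally show "(\<Sum>k\<in>sinks N. - balance N k) = total_supply N"
    using balance_sum by (simp add: sum_negf)
qed

text \<open>All conditions are closed and the box is compact. The last condition bans opposite use
  of an edge through products of rates, because strict inequalities would not survive limits. With
  \<open>\<bar>balance N k\<bar>\<close>, sources and sinks are treated alike: a terminal is the
  start of routes or the target of routes, never both.\<close>

definition admissible :: "(('v, 'e \<times> 'v \<times> 'v) route \<Rightarrow> real) set" where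
  "admissible =
    PiE UNIV (\<lambda>P. if P \<in> routes then {0..sum (capacity N) (edges (graph N))} else {0})
    \<inter> {x. \<forall>P\<in>routes. horizon N < travel P \<longrightarrow> x P = 0}
    \<inter> {x. \<forall>e\<in>edges (graph N). (\<Sum>P\<in>routes. x P * real (count_list (route_edges P) e)) \<le> capacity N e}
    \<inter> {x. \<forall>k\<in>sources N \<union> sinks N. (\<Sum>P | P \<in> routes \<and> (start P = k \<or> target P = k).
          x P * (horizon N - travel P)) \<le> \<bar>balance N k\<bar>}
    \<inter> {x. \<forall>P\<in>routes. \<forall>Q\<in>routes. \<forall>e v w.
          (e, v, w) \<in> set (walk P) \<and> (e, w, v) \<in> set (walk Q) \<and> v \<noteq> w \<longrightarrow> x P * x Q = 0}"

abbreviation route_value :: "(('v, 'e \<times> 'v \<times> 'v) route \<Rightarrow> real) \<Rightarrow> real" where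
  "route_value x \<equiv> (\<Sum>P\<in>routes. x P * (horizon N - travel P))"

lemma compact_admissible: "compact admissible"
  unfolding admissible_def Ball_def
  by (intro compact_Int_closed compact_PiE_UNIV closed_Collect_all closed_Collect_imp open_Collect_const
      closed_Collect_le closed_Collect_eq) (auto intro!: continuous_intros)

text \<open>A route has at least one edge, whose capacity bounds its rate; this supplies the box of
  the definition.\<close>

lemma admissibleI:
  assumes "\<And>P. P \<notin> routes \<Longrightarrow> x P = 0"
    and "\<And>P. P \<in> routes \<Longrightarrow> 0 \<le> x P"
    and "\<And>P. P \<in> routes \<Longrightarrow> horizon N < travel P \<Longrightarrow> x P = 0"
    and usage: "\<And>e. e \<in> edges (graph N) \<Longrightarrow>
      (\<Sum>P\<in>routes. x P * real (count_list (route_edges P) e)) \<le> capacity N e"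
    and "\<And>k. k \<in> sources N \<union> sinks N \<Longrightarrow> (\<Sum>P | P \<in> routes \<and> (start P = k \<or> target P = k).
          x P * (horizon N - travel P)) \<le> \<bar>balance N k\<bar>"
    and "\<And>P Q e v w. P \<in> routes \<Longrightarrow> Q \<in> routes \<Longrightarrow> (e, v, w) \<in> set (walk P) \<Longrightarrow>
      (e, w, v) \<in> set (walk Q) \<Longrightarrow> v \<noteq> w \<Longrightarrow> x P * x Q = 0"
  shows "x \<in> admissible"
proof -
  have "x P \<le> sum (capacity N) (edges (graph N))" if P: "P \<in> routes" for P
  proof -
    obtain e where e: "e \<in> set (route_edges P)"
      using route_props(5)[OF P] by (meson last_in_set)
    then have eE: "e \<in> edges (graph N)" using route_props(4)[OF P] by blast
    have "1 \<le> real (count_list (route_edges P) e)"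
      using e count_list_0_iff[of "route_edges P" e] by linarith
    then have "x P * 1 \<le> x P * real (count_list (route_edges P) e)"
      by (intro mult_left_mono assms(2) P)
    also have "\<dots> \<le> (\<Sum>P\<in>routes. x P * real (count_list (route_edges P) e))"
      using P assms(2) finite_routes by (intro member_le_sum) auto
    also have "\<dots> \<le> capacity N e" by (rule usage[OF eE])
    also have "\<dots> \<le> sum (capacity N) (edges (graph N))"
      using eE finite_edges capacity_nonneg by (intro member_le_sum) auto
    finally show ?thesis by simp
  qed
  then have "x \<in> PiE UNIV (\<lambda>P. if P \<in> routes then {0..sum (capacity N) (edges (graph N))} else {0})"
    using assms(1,2) by (simp add: PiE_iff)
  then show ?thesis
    unfolding admissible_def
    by (intro IntI CollectI ballI allI impI; (elim conjE)?) (assumption | rule assms; assumption)+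
qed

lemma admissibleD:
  assumes "x \<in> admissible"
  shows "P \<notin> routes \<Longrightarrow> x P = 0" "0 \<le> x P"
    and "P \<in> routes \<Longrightarrow> 0 < x P \<Longrightarrow> travel P \<le> horizon N"
    and "e \<in> edges (graph N) \<Longrightarrow>
      (\<Sum>P\<in>routes. x P * real (count_list (route_edges P) e)) \<le> capacity N e"
    and "k \<in> sources N \<union> sinks N \<Longrightarrow> (\<Sum>P | P \<in> routes \<and> (start P = k \<or> target P = k).
          x P * (horizon N - travel P)) \<le> \<bar>balance N k\<bar>"
    and "0 < x P \<Longrightarrow> 0 < x Q \<Longrightarrow> (e, v, w) \<in> set (walk P) \<Longrightarrow> (e, w, v) \<in> set (walk Q) \<Longrightarrow> v = w"
proof -
  note c = assms[unfolded admissible_def Int_iff mem_Collect_eq]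
  have *: "x P \<in> (if P \<in> routes then {0..sum (capacity N) (edges (graph N))} else {0})" for P
    using c[THEN conjunct1, THEN conjunct1, THEN conjunct1, THEN conjunct1] by (rule PiE_mem) simp
  show 1: "P \<notin> routes \<Longrightarrow> x P = 0" and "0 \<le> x P" for P
    using *[of P] by (auto split: if_splits)
  show "travel P \<le> horizon N" if "P \<in> routes" "0 < x P"
    using c[THEN conjunct1, THEN conjunct1, THEN conjunct1, THEN conjunct2, rule_format, OF that(1)]
      that(2) by linarith
  show "e \<in> edges (graph N) \<Longrightarrow>
      (\<Sum>P\<in>routes. x P * real (count_list (route_edges P) e)) \<le> capacity N e"
    using c[THEN conjunct1, THEN conjunct1, THEN conjunct2] by (rule bspec)
  show "k \<in> sources N \<union> sinks N \<Longrightarrow> (\<Sum>P | P \<in> routes \<and> (start P = k \<or> target P = k).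
          x P * (horizon N - travel P)) \<le> \<bar>balance N k\<bar>"
    using c[THEN conjunct1, THEN conjunct2] by (rule bspec)
  assume x: "0 < x P" "0 < x Q" and vw: "(e, v, w) \<in> set (walk P)" "(e, w, v) \<in> set (walk Q)"
  have "P \<in> routes" "Q \<in> routes" using x 1[of P] 1[of Q] by force+
  then have "v \<noteq> w \<Longrightarrow> x P * x Q = 0"
    using c[THEN conjunct2, rule_format, of P Q e v w] vw by blast
  then show "v = w" using x by auto
qed

lemma admissible_zero: "(\<lambda>P. 0) \<in> admissible"
  by (rule admissibleI) (auto simp: capacity_nonneg)

text \<open>A maximiser takes the place of a limit as \<open>\<eta>\<close> tends to 0: it is at
  least as good as every approximate solution.\<close>

lemma admissible_maximum:
  obtains x where "x \<in> admissible" "\<And>x'. x' \<in> admissible \<Longrightarrow> route_value x' \<le> route_value x"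
proof -
  have "\<exists>x\<in>admissible. \<forall>x'\<in>admissible. route_value x' \<le> route_value x"
  proof (rule continuous_attains_sup[OF compact_admissible])
    show "admissible \<noteq> {}" using admissible_zero by blast
    have "continuous_on UNIV route_value" by (auto intro!: continuous_intros)
    then show "continuous_on admissible route_value" by (rule continuous_on_subset) simp
  qed
  then show thesis using that by blast
qed

end

section \<open>Value of a priced route flow and the cut bound\<close>

lemma sum_list_map_count:
  fixes f :: "'a \<Rightarrow> real"
  assumes "finite E" "set xs \<subseteq> E"
  shows "(\<Sum>e\<leftarrow>xs. f e) = (\<Sum>e\<in>E. real (count_list xs e) * f e)"
  using assms(2)
proof (induction xs)
  case (Cons a xs)
  have "(\<Sum>e\<in>E. real (count_list (a # xs) e) * f e)
      = (\<Sum>e\<in>E. real (count_list xs e) * f e + (if a = e then f e else 0))"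
    by (rule sum.cong) (auto simp: algebra_simps)
  then show ?case using Cons assms(1) by (simp add: sum.distrib)
qed simp

text \<open>The conclusions of \<open>path_price_equilibrium\<close> for transit times increased by
  \<open>\<eta>\<close>, with absolute balances as demands.\<close>

locale priced_routes = undirected_network N
  for N :: "('v, 'e) unetwork" +
  fixes \<eta> :: real
    and x :: "('v, 'e \<times> 'v \<times> 'v) route \<Rightarrow> real" and y :: "'e \<Rightarrow> real" and L :: "'v \<Rightarrow> real"
  assumes \<eta>: "0 < \<eta>"
    and x_nonneg: "\<And>P. P \<in> routes \<Longrightarrow> 0 \<le> x P"
    and y_nonneg: "\<And>e. e \<in> edges (graph N) \<Longrightarrow> 0 \<le> y e"
    and L_nonneg: "\<And>k. k \<in> sources N \<union> sinks N \<Longrightarrow> 0 \<le> L k"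
    and slack: "\<And>P. P \<in> routes \<Longrightarrow>
      horizon N \<le> (\<Sum>e\<leftarrow>route_edges P. y e + (transit N e + \<eta>)) + L (start P) + L (target P)"
    and tight: "\<And>P. P \<in> routes \<Longrightarrow> 0 < x P \<Longrightarrow>
      (\<Sum>e\<leftarrow>route_edges P. y e + (transit N e + \<eta>)) + L (start P) + L (target P) \<le> horizon N"
    and usage: "\<And>e. e \<in> edges (graph N) \<Longrightarrow>
      (\<Sum>P\<in>routes. x P * real (count_list (route_edges P) e)) \<le> capacity N e"
    and saturated: "\<And>e. e \<in> edges (graph N) \<Longrightarrow> 0 < y e \<Longrightarrow>
      capacity N e \<le> (\<Sum>P\<in>routes. x P * real (count_list (route_edges P) e))"
    and amount: "\<And>k. k \<in> sources N \<union> sinks N \<Longrightarrow>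
      (\<Sum>P | P \<in> routes \<and> (start P = k \<or> target P = k). x P * (\<Sum>e\<leftarrow>route_edges P. y e)) \<le> \<bar>balance N k\<bar>"
    and fulfilled: "\<And>k. k \<in> sources N \<union> sinks N \<Longrightarrow> 0 < L k \<Longrightarrow>
      \<bar>balance N k\<bar> \<le> (\<Sum>P | P \<in> routes \<and> (start P = k \<or> target P = k). x P * (\<Sum>e\<leftarrow>route_edges P. y e))"
begin

abbreviation cost :: "'e \<times> 'v \<times> 'v \<Rightarrow> real" where
  "cost a \<equiv> y (fst a) + (transit N (fst a) + \<eta>)"

abbreviation window :: "('v, 'e \<times> 'v \<times> 'v) route \<Rightarrow> real" where
  "window P \<equiv> (\<Sum>e\<leftarrow>route_edges P. y e)"

lemma cost_nonneg: "a \<in> arcs bi \<Longrightarrow> 0 \<le> cost a"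
  using \<eta> y_nonneg[of "fst a"] transit_nonneg[of "fst a"] by simp

lemma route_cost: "(\<Sum>e\<leftarrow>route_edges P. y e + (transit N e + \<eta>)) = bi.awalk_cost cost (walk P)"
  by (simp add: bi.awalk_cost_def route_edges_def comp_def)

text \<open>Shortening a walk to a simple path does not raise its cost. Walks are needed because
  exchanging tails of routes need not give simple paths.\<close>

lemma walk_slack:
  assumes "k \<in> sources N" "l \<in> sinks N" "bi.awalk k p l"
  shows "horizon N \<le> bi.awalk_cost cost p + L k + L l"
proof -
  have "(k, bi.awalk_to_apath p, l) \<in> routes"
    using assms bi.apath_awalk_to_apath by (simp add: routes_def)
  from slack[OF this] show ?thesis
    using bi.awalk_to_apath_cost_le[where f = cost, OF assms(3) cost_nonneg] by (simp add: route_cost)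
qed

text \<open>Exchanging the tails of two used routes that pass an edge in opposite directions would save twice
  the cost of that edge.\<close>

lemma no_crossing:
  assumes P: "P \<in> routes" "0 < x P" "(e, v, w) \<in> set (walk P)"
    and Q: "Q \<in> routes" "0 < x Q" "(e, w, v) \<in> set (walk Q)"
  shows False
proof -
  obtain p1 p2 where p: "walk P = p1 @ (e, v, w) # p2" using P(3) by (meson split_list)
  obtain q1 q2 where q: "walk Q = q1 @ (e, w, v) # q2" using Q(3) by (meson split_list)
  have wP: "bi.awalk (start P) p1 v" "bi.awalk w p2 (target P)" and e: "(e, v, w) \<in> arcs bi"
    using route_props(3)[OF P(1)] unfolding p by (auto simp: bi.awalk_Cons_iff)
  have wQ: "bi.awalk (start Q) q1 w" "bi.awalk v q2 (target Q)"
    using route_props(3)[OF Q(1)] unfolding q by (auto simp: bi.awalk_Cons_iff)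
  have "bi.awalk (start P) (p1 @ q2) (target Q)" "bi.awalk (start Q) (q1 @ p2) (target P)"
    by (rule bi.awalk_appendI[OF wP(1) wQ(2)] bi.awalk_appendI[OF wQ(1) wP(2)])+
  then have "horizon N \<le> bi.awalk_cost cost (p1 @ q2) + L (start P) + L (target Q)"
    "horizon N \<le> bi.awalk_cost cost (q1 @ p2) + L (start Q) + L (target P)"
    using route_props(1,2)[OF P(1)] route_props(1,2)[OF Q(1)] walk_slack by blast+
  moreover have "bi.awalk_cost cost (walk P) + L (start P) + L (target P) \<le> horizon N"
    "bi.awalk_cost cost (walk Q) + L (start Q) + L (target Q) \<le> horizon N"
    using tight[OF P(1,2)] tight[OF Q(1,2)] by (simp_all add: route_cost)
  \<comment> \<open>If price and transit time both vanish, only \<open>\<eta>\<close> makes this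
    strict.\<close>
  moreover have "0 < cost (e, v, w)"
    using e \<eta> y_nonneg[of e] transit_nonneg[of e] by simp
  ultimately show False by (simp add: p q)
qed

abbreviation total :: real where
  "total \<equiv> (\<Sum>P\<in>routes. x P * window P)"

text \<open>Double counting over routes and edges; an edge of positive price is used to its full
  capacity.\<close>

lemma total_eq_edges: "total = (\<Sum>e\<in>edges (graph N). capacity N e * y e)"
proof -
  have "total = (\<Sum>P\<in>routes. \<Sum>e\<in>edges (graph N). y e * (x P * real (count_list (route_edges P) e)))"
  proof (rule sum.cong[OF refl])
    fix P assume P: "P \<in> routes"
    have "window P = (\<Sum>e\<in>edges (graph N). real (count_list (route_edges P) e) * y e)"
      by (rule sum_list_map_count[OF finite_edges route_props(4)[OF P]])
    then show "x P * window P = (\<Sum>e\<in>edges (graph N). y e * (x P * real (count_list (route_edges P) e)))"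
      by (simp add: sum_distrib_left mult_ac)
  qed
  also have "\<dots> = (\<Sum>e\<in>edges (graph N). y e * (\<Sum>P\<in>routes. x P * real (count_list (route_edges P) e)))"
    by (subst sum.swap) (simp add: sum_distrib_left)
  also have "\<dots> = (\<Sum>e\<in>edges (graph N). capacity N e * y e)"
  proof (rule sum.cong[OF refl])
    fix e assume e: "e \<in> edges (graph N)"
    show "y e * (\<Sum>P\<in>routes. x P * real (count_list (route_edges P) e)) = capacity N e * y e"
      using usage[OF e] saturated[OF e] y_nonneg[OF e] by (cases "y e = 0") auto
  qed
  finally show ?thesis .
qed

lemma window_nonneg: "P \<in> routes \<Longrightarrow> 0 \<le> window P"
  using y_nonneg route_props(4)[of P] by (intro sum_list_nonneg) auto

text \<open>Delayed terminals are fully served. As \<open>A\<close> lies on one side, a route meets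
  at most one of its members and is counted at most once.\<close>

lemma fulfilled_le_total:
  assumes A: "A \<subseteq> sources N \<or> A \<subseteq> sinks N" and L: "\<And>k. k \<in> A \<Longrightarrow> 0 < L k"
  shows "(\<Sum>k\<in>A. \<bar>balance N k\<bar>) \<le> total"
proof -
  have fin: "finite A" using A finite_terminals by (auto intro: finite_subset)
  have disj: "{P \<in> routes. start P = k \<or> target P = k} \<inter> {P \<in> routes. start P = l \<or> target P = l} = {}"
    if "k \<in> A" "l \<in> A" "k \<noteq> l" for k l
    using that A route_props(1,2) disjoint_terminals by (auto simp: disjoint_iff)
  have "(\<Sum>k\<in>A. \<bar>balance N k\<bar>) \<le> (\<Sum>k\<in>A. \<Sum>P | P \<in> routes \<and> (start P = k \<or> target P = k). x P * window P)"
    using fulfilled L A by (intro sum_mono) blast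
  also have "\<dots> = (\<Sum>P\<in>(\<Union>k\<in>A. {P. P \<in> routes \<and> (start P = k \<or> target P = k)}). x P * window P)"
    using fin disj finite_routes by (intro sum.UNION_disjoint[symmetric]) auto
  also have "\<dots> \<le> total"
    using finite_routes x_nonneg window_nonneg
    by (intro sum_mono2) (auto intro!: mult_nonneg_nonneg)
  finally show ?thesis .
qed

text \<open>A lower rate spreads the amount sent by a route during a period of length \<open>window P\<close> over its
  whole usable period.\<close>

definition rescaled :: "('v, 'e \<times> 'v \<times> 'v) route \<Rightarrow> real" where
  "rescaled P = (if P \<in> routes \<and> travel P < horizon N then x P * window P / (horizon N - travel P) else 0)"

text \<open>For a used route, tightness fits price sum, travel time and nonnegative further terms
  into the horizon. Hence \<open>rescaled\<close> only lowers rates.\<close>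

lemma window_le:
  assumes "P \<in> routes"
  shows "x P * window P \<le> x P * (horizon N - travel P)"
proof (cases "x P = 0")
  case False
  then have x: "0 < x P" using x_nonneg[OF assms] by simp
  have "window P + travel P + real (length (route_edges P)) * \<eta> + L (start P) + L (target P) \<le> horizon N"
    using tight[OF assms x] by (simp add: sum_list_addf sum_list_triv)
  moreover have "0 \<le> real (length (route_edges P)) * \<eta>" using \<eta> by simp
  ultimately show ?thesis
    using L_nonneg[of "start P"] L_nonneg[of "target P"] route_props(1,2)[OF assms] x by simp
qed simp

lemma rescaled_amount:
  assumes "P \<in> routes"
  shows "rescaled P * (horizon N - travel P) = x P * window P"
proof (cases "travel P < horizon N")
  case False
  \<comment> \<open>A route that leaves no time to send carries the amount 0, in accordance with the
    default value of \<open>rescaled\<close>.\<close>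
  have "x P * window P \<le> 0"
    using False window_le[OF assms] mult_nonneg_nonpos[OF x_nonneg[OF assms], of "horizon N - travel P"] by simp
  moreover have "0 \<le> x P * window P"
    by (intro mult_nonneg_nonneg x_nonneg window_nonneg assms)
  ultimately have "x P * window P = 0" by (rule antisym)
  then show ?thesis using False unfolding rescaled_def by simp
qed (use assms in \<open>simp add: rescaled_def\<close>)

lemma rescaled_bounds:
  assumes "P \<in> routes"
  shows "0 \<le> rescaled P" "rescaled P \<le> x P"
  using assms window_le[OF assms] x_nonneg[OF assms] window_nonneg[OF assms]
  by (auto simp: rescaled_def divide_le_eq)

lemma rescaled_admissible: "rescaled \<in> admissible"
proof (rule admissibleI)
  show "rescaled P = 0" if "P \<notin> routes" for P using that by (simp add: rescaled_def)
  show "0 \<le> rescaled P" if "P \<in> routes" for P by (rule rescaled_bounds(1)[OF that])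
  show "rescaled P = 0" if "horizon N < travel P" for P using that by (simp add: rescaled_def)
  show "(\<Sum>P\<in>routes. rescaled P * real (count_list (route_edges P) e)) \<le> capacity N e"
    if "e \<in> edges (graph N)" for e
    by (rule order_trans[OF _ usage[OF that]]) (intro sum_mono mult_right_mono rescaled_bounds, auto)
  show "(\<Sum>P | P \<in> routes \<and> (start P = k \<or> target P = k). rescaled P * (horizon N - travel P)) \<le> \<bar>balance N k\<bar>"
    if "k \<in> sources N \<union> sinks N" for k
    using amount[OF that] by (simp add: rescaled_amount)
  show "rescaled P * rescaled Q = 0" if PQ: "P \<in> routes" "Q \<in> routes"
    and vw: "(e, v, w) \<in> set (walk P)" "(e, w, v) \<in> set (walk Q)" for P Q e v w
  proof (rule ccontr)
    assume "rescaled P * rescaled Q \<noteq> 0"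
    then have "0 < x P" "0 < x Q"
      using rescaled_bounds[OF PQ(1)] rescaled_bounds[OF PQ(2)] by force+
    from no_crossing[OF PQ(1) this(1) vw(1) PQ(2) this(2) vw(2)] show False .
  qed
qed

lemma route_value_rescaled: "route_value rescaled = total"
  by (rule sum.cong) (simp_all add: rescaled_amount)

text \<open>A delayed single terminal is fully served, which settles the claim at once. Otherwise
  the terminals on the other side are split: the delayed ones are paid for by \<open>total\<close>,
  the undelayed ones by the cut, whose bound is \<open>total\<close> plus the error term.\<close>

lemma half_le_total:
  assumes single: "card (sources N) = 1 \<or> card (sinks N) = 1"
    and send: "can_send_undirected N (total_supply N)"
  shows "total_supply N - \<eta> * sum (capacity N) (edges (graph N)) \<le> 2 * total"
proof -
  define B where "B = total_supply N"
  define h_bound where "h_bound = total + \<eta> * sum (capacity N) (edges (graph N))"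
  \<comment> \<open>The distances use the increased transit times but the cut uses the true ones, so
    \<open>\<eta>\<close> is added to each price.\<close>
  have slop: "(\<Sum>e\<in>edges (graph N). capacity N e * (y e + \<eta>)) = h_bound"
    by (simp add: h_bound_def total_eq_edges distrib_left sum.distrib sum_distrib_left mult.commute)
  have cap0: "0 \<le> \<eta> * sum (capacity N) (edges (graph N))"
    using \<eta> capacity_nonneg by (intro mult_nonneg_nonneg sum_nonneg) auto
  have total0: "0 \<le> total"
    by (intro sum_nonneg mult_nonneg_nonneg x_nonneg window_nonneg)
  obtain g where g: "flow_over_time (bidirection N) g"
    and sent: "B \<le> flow_value (bidirection N) g"
    using send by (auto simp: can_send_undirected_def undirected_flow_over_time_def B_def)
  let ?ex = "excess (bidirection N) g"
  have conserves: "conserves_at (bidirection N) g v" if "v \<in> nodes (graph N)" for v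
    using g that by (simp add: flow_over_time_def)
  have T: "horizon N \<in> {0..horizon N}" using horizon_nonneg by simp
  \<comment> \<open>No sink accepts more than its demand, so the value \<open>B\<close> forces every
    sink to be served in full.\<close>
  have sink: "?ex k (horizon N) = - balance N k" if k: "k \<in> sinks N" for k
  proof (rule ccontr)
    assume ne: "?ex k (horizon N) \<noteq> - balance N k"
    have le: "?ex l (horizon N) \<le> - balance N l" if "l \<in> sinks N" for l
      using conserves[of l] that T by (auto simp: conserves_at_def sinks_def)
    have "(\<Sum>l\<in>sinks N. ?ex l (horizon N)) < (\<Sum>l\<in>sinks N. - balance N l)"
      by (rule sum_strict_mono_ex1[OF finite_terminals(2)]) (use le k ne in force)+
    then show False using sent by (simp add: flow_value_def sum_terminals(2)[folded B_def] flip: sinks_def)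
  qed
  have cut: "(\<Sum>v\<in>nodes (graph N). ?ex v (h v)) \<le> h_bound"
    if "\<And>v. v \<in> nodes (graph N) \<Longrightarrow> h v \<in> {0..horizon N}"
      and "\<And>a. a \<in> arcs bi \<Longrightarrow> h (head bi a) \<le> h (tail bi a) + cost a" for h
    unfolding slop[symmetric]
    by (rule excess_cut_undirected[OF g that(1)])
      (use that(2) y_nonneg \<eta> in \<open>force intro: add_nonneg_nonneg\<close>)+
  have ex_nonneg: "0 \<le> ?ex v \<theta>"
    if "v \<in> nodes (graph N)" "v \<notin> sources N" "\<theta> \<in> {0..horizon N}" for v \<theta>
    using conserves[OF that(1)] that
    by (cases "balance N v" "0 :: real" rule: linorder_cases) (auto simp: conserves_at_def sources_def)
  have ex_start: "?ex v 0 = 0" for v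
    by (rule excess_start) (simp add: transit_nonneg)
  have ex_source: "- balance N v \<le> ?ex v \<theta>" if "v \<in> sources N" "\<theta> \<in> {0..horizon N}" for v \<theta>
    using conserves[of v] that by (auto simp: conserves_at_def sources_def)
  have sub: "sources N \<subseteq> nodes (graph N)" "sinks N \<subseteq> nodes (graph N)"
    by (auto simp: sources_def sinks_def)
  from single show ?thesis
  proof
    assume "card (sources N) = 1"
    then obtain s where s: "sources N = {s}" by (auto simp: card_1_singleton_iff)
    show ?thesis
    proof (cases "0 < L s")
      case True
      have "s \<in> sources N" using s by simp
      then have "\<bar>balance N s\<bar> = balance N s" by (simp add: sources_def)
      then have "B \<le> total"
        using fulfilled_le_total[of "{s}"] True s sum_terminals(1) by (auto simp: B_def)
      then show ?thesis using total0 cap0 by (simp add: B_def)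
    next
      case False
      then have L: "L s = 0" using L_nonneg[of s] s by simp
      define A where "A = {k \<in> sinks N. 0 < L k}"
      \<comment> \<open>The source is cut at time 0, where its excess is 0; undelayed sinks are cut
        at the horizon, where they hold their full demand.\<close>
      define h where "h = bi.capped_dist (horizon N) cost s"
      have h: "h v \<in> {0..horizon N}" for v
        using bi.capped_dist_nonneg[where f = cost, OF horizon_nonneg cost_nonneg] bi.capped_dist_le by (simp add: h_def)
      have hs: "h s = 0"
        using bi.capped_dist_self[where f = cost, OF horizon_nonneg cost_nonneg, of s] s sub by (simp add: h_def)
      have hk: "h k = horizon N" if "k \<in> sinks N - A" for k
        unfolding h_def
      proof (rule bi.capped_dist_eq_cap)
        fix p assume "bi.apath s p k"
        then show "horizon N \<le> bi.awalk_cost cost p"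
          using walk_slack[of s k p] L L_nonneg[of k] that s by (auto simp: bi.apath_def A_def)
      qed
      have "(\<Sum>k\<in>sinks N - A. - balance N k) \<le> (\<Sum>v\<in>nodes (graph N). ?ex v (h v))"
      proof -
        have "(\<Sum>k\<in>sinks N - A. - balance N k) = (\<Sum>v\<in>sinks N - A. ?ex v (h v))"
          using hk sink by simp
        also have "\<dots> \<le> (\<Sum>v\<in>nodes (graph N). ?ex v (h v))"
        proof (rule sum_mono2[OF finite_nodes])
          show "sinks N - A \<subseteq> nodes (graph N)" using sub by blast
          show "0 \<le> ?ex v (h v)" if "v \<in> nodes (graph N) - (sinks N - A)" for v
            using that ex_nonneg[OF _ _ h, of v] hs ex_start s by (cases "v = s") auto
        qed
        finally show ?thesis .
      qed
      also have "\<dots> \<le> h_bound"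
        by (rule cut) (use h bi.capped_dist_head_le[where f = cost, OF _ cost_nonneg] in \<open>simp_all add: h_def\<close>)
      finally have "(\<Sum>k\<in>sinks N - A. - balance N k) \<le> h_bound" .
      moreover have "(\<Sum>k\<in>A. - balance N k) \<le> total"
      proof -
        have "(\<Sum>k\<in>A. - balance N k) = (\<Sum>k\<in>A. \<bar>balance N k\<bar>)"
          by (rule sum.cong) (auto simp: A_def sinks_def)
        also have "\<dots> \<le> total" by (rule fulfilled_le_total) (auto simp: A_def)
        finally show ?thesis .
      qed
      moreover have "(\<Sum>k\<in>sinks N. - balance N k) = (\<Sum>k\<in>sinks N - A. - balance N k) + (\<Sum>k\<in>A. - balance N k)"
        by (rule sum.subset_diff) (auto simp: A_def finite_terminals)
      ultimately show ?thesis by (simp add: sum_terminals(2) h_bound_def)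
    qed
  next
    assume "card (sinks N) = 1"
    then obtain t where t: "sinks N = {t}" by (auto simp: card_1_singleton_iff)
    have bt: "- balance N t = B" using sum_terminals(2) t by (simp add: B_def)
    show ?thesis
    proof (cases "0 < L t")
      case True
      have "t \<in> sinks N" using t by simp
      then have "\<bar>balance N t\<bar> = - balance N t" by (simp add: sinks_def)
      then have "B \<le> total"
        using fulfilled_le_total[of "{t}"] True t bt by auto
      then show ?thesis using total0 cap0 by (simp add: B_def)
    next
      case False
      then have L: "L t = 0" using L_nonneg[of t] t by simp
      define A where "A = {k \<in> sources N. 0 < L k}"
      \<comment> \<open>The latest departure for \<open>t\<close> at the given costs:
        \<open>t\<close> is cut at the horizon and undelayed sources at time 0, before they have
        sent anything.\<close>
      define h where "h v = horizon N - bi.capped_dist (horizon N) cost v t" for v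
      have h: "h v \<in> {0..horizon N}" for v
        using bi.capped_dist_nonneg[where f = cost, OF horizon_nonneg cost_nonneg] bi.capped_dist_le by (simp add: h_def)
      have ht: "h t = horizon N"
        using bi.capped_dist_self[where f = cost, OF horizon_nonneg cost_nonneg, of t] t sub by (simp add: h_def)
      have hk: "h k = 0" if "k \<in> sources N - A" for k
      proof -
        have "bi.capped_dist (horizon N) cost k t = horizon N"
        proof (rule bi.capped_dist_eq_cap)
          fix p assume "bi.apath k p t"
          then show "horizon N \<le> bi.awalk_cost cost p"
            using walk_slack[of k t p] L L_nonneg[of k] that t by (auto simp: bi.apath_def A_def)
        qed
        then show ?thesis by (simp add: h_def)
      qed
      have tA: "t \<notin> A" using t disjoint_terminals by (auto simp: A_def)
      \<comment> \<open>The sink has received \<open>B\<close> in all; a delayed source may have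
        excess as low as minus its balance, and other nodes contribute nothing negative.\<close>
      have "B - (\<Sum>k\<in>A. balance N k) = (\<Sum>v\<in>insert t A. if v = t then ?ex t (h t) else - balance N v)"
      proof -
        have "finite A" using finite_terminals by (simp add: A_def)
        moreover have "(\<Sum>v\<in>A. if v = t then ?ex t (h t) else - balance N v) = (\<Sum>v\<in>A. - balance N v)"
          by (rule sum.cong) (use tA in auto)
        ultimately show ?thesis using tA sink[of t] t bt ht by (simp add: sum_negf)
      qed
      also have "\<dots> \<le> (\<Sum>v\<in>insert t A. ?ex v (h v))"
        by (intro sum_mono) (use ex_source h in \<open>auto simp: A_def\<close>)
      also have "\<dots> \<le> (\<Sum>v\<in>nodes (graph N). ?ex v (h v))"
      proof (rule sum_mono2[OF finite_nodes])
        show "insert t A \<subseteq> nodes (graph N)" using sub t by (auto simp: A_def)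
        show "0 \<le> ?ex v (h v)" if "v \<in> nodes (graph N) - insert t A" for v
          using that ex_nonneg[of v "h v"] h hk[of v] ex_start by (cases "v \<in> sources N") auto
      qed
      also have "\<dots> \<le> h_bound"
      proof (rule cut)
        show "h (head bi a) \<le> h (tail bi a) + cost a" if "a \<in> arcs bi" for a
          using bi.capped_dist_tail_le[where f = cost, OF that cost_nonneg, of "horizon N" t] by (simp add: h_def)
      qed (rule h)
      finally have "B - (\<Sum>k\<in>A. balance N k) \<le> h_bound" .
      moreover have "(\<Sum>k\<in>A. balance N k) \<le> total"
      proof -
        have "(\<Sum>k\<in>A. balance N k) = (\<Sum>k\<in>A. \<bar>balance N k\<bar>)"
          by (rule sum.cong) (auto simp: A_def sources_def)
        also have "\<dots> \<le> total" by (rule fulfilled_le_total) (auto simp: A_def)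
        finally show ?thesis .
      qed
      ultimately show ?thesis by (simp add: B_def h_bound_def)
    qed
  qed
qed

end

section \<open>From priced routes to an orientation\<close>

context undirected_network
begin

lemma admissible_nearly_half:
  assumes single: "card (sources N) = 1 \<or> card (sinks N) = 1"
    and send: "can_send_undirected N (total_supply N)" and \<eta>: "0 < \<eta>"
  obtains x where "x \<in> admissible"
    "total_supply N - \<eta> * sum (capacity N) (edges (graph N)) \<le> 2 * route_value x"
proof -
  have K: "0 < \<bar>balance N k\<bar>" if "k \<in> sources N \<union> sinks N" for k
    using that by (auto simp: sources_def sinks_def)
  have finK: "finite (sources N \<union> sinks N)" using finite_terminals by simp
  obtain x y L where "priced_routes N \<eta> x y L"
  proof (rule path_price_equilibrium[of routes "edges (graph N)" "sources N \<union> sinks N" route_edges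
        start target "capacity N" "\<lambda>e. transit N e + \<eta>" "\<lambda>k. \<bar>balance N k\<bar>" "horizon N",
        OF finite_routes finite_edges finK route_props(4,5) _ _ capacity_nonneg _ K horizon_nonneg])
    show "start P \<in> sources N \<union> sinks N" "target P \<in> sources N \<union> sinks N" if "P \<in> routes" for P
      using route_props(1,2)[OF that] by auto
    show "0 \<le> transit N e + \<eta>" if "e \<in> edges (graph N)" for e
      using transit_nonneg[OF that] \<eta> by simp
    show thesis if "\<And>P. P \<in> routes \<Longrightarrow> 0 \<le> x P" "\<And>e. e \<in> edges (graph N) \<Longrightarrow> 0 \<le> y e"
      "\<And>k. k \<in> sources N \<union> sinks N \<Longrightarrow> 0 \<le> L k"
      "\<And>P. P \<in> routes \<Longrightarrow>
        horizon N \<le> (\<Sum>e\<leftarrow>route_edges P. y e + (transit N e + \<eta>)) + L (start P) + L (target P)"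
      "\<And>P. P \<in> routes \<Longrightarrow> 0 < x P \<Longrightarrow>
        (\<Sum>e\<leftarrow>route_edges P. y e + (transit N e + \<eta>)) + L (start P) + L (target P) \<le> horizon N"
      "\<And>e. e \<in> edges (graph N) \<Longrightarrow>
        (\<Sum>P\<in>routes. x P * real (count_list (route_edges P) e)) \<le> capacity N e"
      "\<And>e. e \<in> edges (graph N) \<Longrightarrow> 0 < y e \<Longrightarrow>
        capacity N e \<le> (\<Sum>P\<in>routes. x P * real (count_list (route_edges P) e))"
      "\<And>k. k \<in> sources N \<union> sinks N \<Longrightarrow>
        (\<Sum>P | P \<in> routes \<and> (start P = k \<or> target P = k). x P * (\<Sum>e\<leftarrow>route_edges P. y e)) \<le> \<bar>balance N k\<bar>"
      "\<And>k. k \<in> sources N \<union> sinks N \<Longrightarrow> 0 < L k \<Longrightarrow>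
        \<bar>balance N k\<bar> \<le> (\<Sum>P | P \<in> routes \<and> (start P = k \<or> target P = k). x P * (\<Sum>e\<leftarrow>route_edges P. y e))"
      for x y L
    proof (rule \<open>\<And>x y L. priced_routes N \<eta> x y L \<Longrightarrow> thesis\<close>)
      show "priced_routes N \<eta> x y L"
        by (intro priced_routes.intro undirected_network_axioms priced_routes_axioms.intro \<eta>)
          (fact that)+
    qed
  qed
  then interpret priced_routes N \<eta> x y L .
  show thesis
    by (rule that[OF rescaled_admissible])
      (use half_le_total[OF single send] in \<open>simp only: route_value_rescaled\<close>)
qed

lemma admissible_half:
  assumes "card (sources N) = 1 \<or> card (sinks N) = 1" "can_send_undirected N (total_supply N)"
  obtains x where "x \<in> admissible" "total_supply N / 2 \<le> route_value x"
proof -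
  obtain x where x: "x \<in> admissible" "\<And>x'. x' \<in> admissible \<Longrightarrow> route_value x' \<le> route_value x"
    by (rule admissible_maximum) blast
  define C where "C = sum (capacity N) (edges (graph N))"
  have "0 \<le> C" unfolding C_def by (intro sum_nonneg capacity_nonneg)
  have "total_supply N \<le> 2 * route_value x + e" if "0 < e" for e
  proof -
    \<comment> \<open>Dividing by \<open>C + 1\<close> keeps the error term below \<open>e\<close>
      even if all capacities are 0.\<close>
    have "0 < e / (C + 1)" using that \<open>0 \<le> C\<close> by simp
    from admissible_nearly_half[OF assms this] obtain x' where
      x': "x' \<in> admissible" "total_supply N - e / (C + 1) * C \<le> 2 * route_value x'"
      unfolding C_def by blast
    have "e / (C + 1) * C \<le> e" using that \<open>0 \<le> C\<close> by (simp add: field_simps)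
    then show ?thesis using x' x(2)[OF x'(1)] by linarith
  qed
  then have "total_supply N \<le> 2 * route_value x" by (rule field_le_epsilon)
  then show thesis using that x(1) by simp
qed

lemma orientation_of_admissible:
  assumes x: "x \<in> admissible"
  obtains M where "orientation N M" "can_send M (route_value x)"
proof -
  note adm = admissibleD[OF x]
  define U where "U = {P \<in> routes. 0 < x P}"
  have U: "P \<in> routes" "0 < x P" if "P \<in> U" for P using that by (auto simp: U_def)
  have finU: "finite U" using finite_routes by (simp add: U_def)
  define D where "D e vw \<longleftrightarrow> ends (graph N) e = {fst vw, snd vw} \<and>
    (\<forall>P\<in>U. \<forall>a\<in>set (walk P). fst a = e \<longrightarrow> snd a = vw)" for e and vw :: "'v \<times> 'v"
  have arc: "a \<in> arcs bi" if "P \<in> U" "a \<in> set (walk P)" for P a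
    using route_props(3)[OF U(1)[OF that(1)]] that(2) by (auto simp: bi.awalk_def)
  have "\<exists>vw. D e vw" if e: "e \<in> edges (graph N)" for e
  proof (cases "\<exists>P\<in>U. \<exists>a\<in>set (walk P). fst a = e")
    case True
    then obtain P v w where P: "P \<in> U" "(e, v, w) \<in> set (walk P)" by force
    have vw: "ends (graph N) e = {v, w}" using arc[OF P] by simp
    have "snd a = (v, w)" if Q: "Q \<in> U" "a \<in> set (walk Q)" "fst a = e" for Q a
    proof -
      obtain v' w' where a: "a = (e, v', w')" using Q(3) by (cases a) auto
      then have "{v', w'} = {v, w}" using arc[OF Q(1,2)] vw by simp
      then consider "v' = v" "w' = w" | "v' = w" "w' = v" by (auto simp: doubleton_eq_iff)
      then show ?thesis
        using adm(6)[OF U(2)[OF P(1)] U(2)[OF Q(1)] P(2)] Q(2) a by cases auto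
    qed
    then show ?thesis using vw by (intro exI[of _ "(v, w)"]) (auto simp: D_def)
  next
    case False
    from ends[OF e] obtain v w where "ends (graph N) e = {v, w}" by blast
    then show ?thesis using False by (intro exI[of _ "(v, w)"]) (auto simp: D_def)
  qed
  then obtain dir where dir: "\<And>e. e \<in> edges (graph N) \<Longrightarrow> D e (dir e)" by metis
  define M where "M = \<lparr>graph = \<lparr>verts = nodes (graph N), arcs = edges (graph N),
      tail = (\<lambda>e. fst (dir e)), head = (\<lambda>e. snd (dir e))\<rparr>,
    capacity = capacity N, balance = balance N, transit = transit N, horizon = horizon N\<rparr>"
  have M: "verts (graph M) = nodes (graph N)" "arcs (graph M) = edges (graph N)"
    "tail (graph M) e = fst (dir e)" "head (graph M) e = snd (dir e)"
    "capacity M = capacity N" "balance M = balance N" "transit M = transit N" "horizon M = horizon N" for e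
    by (simp_all add: M_def)
  have orient: "orientation N M"
    using dir by (auto simp: orientation_def M D_def)
  have used: "snd a = dir (fst a)" if "P \<in> U" "a \<in> set (walk P)" for P a
    using dir[of "fst a"] arc[OF that] that by (auto simp: D_def)
  have cas: "pre_digraph.cas (graph M) v (map fst p) w"
    if "bi.cas v p w" "\<And>a. a \<in> set p \<Longrightarrow> snd a = dir (fst a)" for v p w
    using that by (induction p arbitrary: v) (auto simp: pre_digraph.cas.simps M)
  \<comment> \<open>Forgetting directions must not merge routes, since rates are summed over a set
    of them; \<open>lift\<close> restores the directions from \<open>dir\<close>.\<close>
  define img :: "('v, 'e \<times> 'v \<times> 'v) route \<Rightarrow> ('v, 'e) route"
    where "img P = (start P, route_edges P, target P)" for P
  define lift :: "('v, 'e) route \<Rightarrow> ('v, 'e \<times> 'v \<times> 'v) route"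
    where "lift P = (start P, map (\<lambda>e. (e, dir e)) (walk P), target P)" for P
  have lift: "lift (img P) = P" if P: "P \<in> U" for P
  proof -
    have "map (\<lambda>e. (e, dir e)) (route_edges P) = walk P"
      using used[OF P] by (simp add: route_edges_def comp_def map_idI prod_eq_iff)
    then show ?thesis by (simp add: lift_def img_def)
  qed
  then have inj: "inj_on img U" by (metis inj_on_inverseI)
  let ?R = "img ` U" and ?x = "\<lambda>P. x (lift P)"
  have sum_img: "(\<Sum>P\<in>?R. ?x P * F P) = (\<Sum>P\<in>routes. x P * F (img P))" for F
  proof -
    have "(\<Sum>P\<in>?R. ?x P * F P) = (\<Sum>P\<in>U. x P * F (img P))"
      using lift by (simp add: sum.reindex[OF inj])
    also have "\<dots> = (\<Sum>P\<in>routes. x P * F (img P))"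
      by (rule sum.mono_neutral_left) (use adm(2) finite_routes in \<open>auto simp: U_def less_le\<close>)
    finally show ?thesis .
  qed
  have img_simps: "start (img P) = start P" "walk (img P) = route_edges P" "target (img P) = target P" for P
    by (simp_all add: img_def)
  have amount: "(\<Sum>P | P \<in> ?R \<and> (start P = k \<or> target P = k). ?x P * (horizon N - (\<Sum>e\<leftarrow>walk P. transit N e)))
      \<le> \<bar>balance N k\<bar>" if "k \<in> sources N \<union> sinks N" for k
  proof -
    have "(\<Sum>P | P \<in> ?R \<and> (start P = k \<or> target P = k). ?x P * (horizon N - (\<Sum>e\<leftarrow>walk P. transit N e)))
       = (\<Sum>P\<in>?R. ?x P * (if start P = k \<or> target P = k then horizon N - (\<Sum>e\<leftarrow>walk P. transit N e) else 0))"
      using finU by (subst sum.inter_filter) (auto intro!: sum.cong)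
    also have "\<dots> = (\<Sum>P\<in>routes. x P * (if start P = k \<or> target P = k then horizon N - travel P else 0))"
      unfolding sum_img img_simps ..
    also have "\<dots> = (\<Sum>P | P \<in> routes \<and> (start P = k \<or> target P = k). x P * (horizon N - travel P))"
      using finite_routes by (subst sum.inter_filter) (auto intro!: sum.cong)
    also note adm(5)[OF that]
    finally show ?thesis .
  qed
  have R_ends: "start P \<in> sources N" "target P \<in> sinks N" if P: "P \<in> ?R" for P
  proof -
    obtain Q where "Q \<in> U" "P = img Q" using P by blast
    then show "start P \<in> sources N" "target P \<in> sinks N"
      using route_props(1,2)[OF U(1)] by (simp_all add: img_simps)
  qed
  interpret repeated_routes M ?R ?x
  proof
    fix e assume e: "e \<in> arcs (graph M)"
    then have "ends (graph N) e = {fst (dir e), snd (dir e)}" using dir by (simp add: M D_def)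
    then show "tail (graph M) e \<in> verts (graph M)" "head (graph M) e \<in> verts (graph M)"
      using ends[of e] e by (auto simp: M doubleton_eq_iff)
    show "0 \<le> transit M e" using transit_nonneg e by (simp add: M)
    show "(\<Sum>P\<in>?R. ?x P * real (count_list (walk P) e)) \<le> capacity M e"
      unfolding sum_img img_simps M using adm(4) e by (simp add: M)
  next
    show "finite (verts (graph M))" "finite (arcs (graph M))" "finite ?R"
      using finite_nodes finite_edges finU by (simp_all add: M)
  next
    fix P' assume "P' \<in> ?R"
    then obtain P where P: "P \<in> U" "P' = img P" by blast
    have w: "bi.awalk (start P) (walk P) (target P)" by (rule route_props(3)[OF U(1)[OF P(1)]])
    then show "pre_digraph.awalk (graph M) (start P') (walk P') (target P')"
      unfolding P(2) img_simps pre_digraph.awalk_def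
      using route_props(4)[OF U(1)[OF P(1)]] cas[OF _ used[OF P(1)]]
      by (auto simp: M bi.awalk_def route_edges_def)
    show "0 < balance M (start P')" "balance M (target P') < 0"
      using R_ends[OF \<open>P' \<in> ?R\<close>] by (auto simp: M sources_def sinks_def)
    show "0 \<le> x (lift P')" by (rule adm(2))
    show "(\<Sum>e\<leftarrow>walk P'. transit M e) \<le> horizon M"
      using adm(3)[OF U[OF P(1)]] by (simp add: P(2) img_simps M)
  next
    fix k
    show "(\<Sum>P | P \<in> ?R \<and> start P = k. ?x P * (horizon M - (\<Sum>e\<leftarrow>walk P. transit M e))) \<le> balance M k"
      if k: "0 < balance M k"
    proof (cases "k \<in> nodes (graph N)")
      case True
      then have ks: "k \<in> sources N" using k by (simp add: sources_def M)
      then have "{P. P \<in> ?R \<and> start P = k} = {P. P \<in> ?R \<and> (start P = k \<or> target P = k)}"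
        using R_ends disjoint_terminals by blast
      then show ?thesis using amount[of k] ks k by (simp only: M) simp
    next
      \<comment> \<open>Balances outside \<open>nodes (graph N)\<close> are arbitrary, but no route
        starts there.\<close>
      case False
      then have "k \<notin> sources N" by (simp add: sources_def)
      then have "{P. P \<in> ?R \<and> start P = k} = {}" using R_ends(1) by blast
      then show ?thesis using k by (simp only: sum.empty less_imp_le)
    qed
    show "(\<Sum>P | P \<in> ?R \<and> target P = k. ?x P * (horizon M - (\<Sum>e\<leftarrow>walk P. transit M e))) \<le> - balance M k"
      if k: "balance M k < 0"
    proof (cases "k \<in> nodes (graph N)")
      case True
      then have ks: "k \<in> sinks N" using k by (simp add: sinks_def M)
      then have "{P. P \<in> ?R \<and> target P = k} = {P. P \<in> ?R \<and> (start P = k \<or> target P = k)}"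
        using R_ends disjoint_terminals by blast
      then show ?thesis using amount[of k] ks k by (simp only: M) simp
    next
      case False
      then have "k \<notin> sinks N" by (simp add: sinks_def)
      then have "{P. P \<in> ?R \<and> target P = k} = {}" using R_ends(2) by blast
      then show ?thesis using k by (simp only: sum.empty)
    qed
  qed
  have "flow_value M (repeated M ?R ?x) = route_value x"
    unfolding flow_value_repeated sum_img img_simps M ..
  then have "can_send M (route_value x)"
    using flow_over_time_repeated by (auto simp: can_send_def)
  with orient show thesis by (rule that)
qed

theorem orientation_sending_half:
  assumes "card (sources N) = 1 \<or> card (sinks N) = 1" "can_send_undirected N (total_supply N)"
  shows "\<exists>M. orientation N M \<and> can_send M (total_supply N / 2)"
proof -
  obtain x where x: "x \<in> admissible" "total_supply N / 2 \<le> route_value x"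
    by (rule admissible_half[OF assms])
  obtain M where "orientation N M" "can_send M (route_value x)"
    by (rule orientation_of_admissible[OF x(1)])
  then show ?thesis using x(2) unfolding can_send_def by (meson order_trans)
qed

end

section \<open>Tightness\<close>

text \<open>Node 0 is the single terminal of its kind.  All of the demand of node 3 has to travel 0-1-2-3,
  since 0-2-3 takes the whole time horizon, and this uses up edge 0, so that node 1 has to be served
  along 0-2-1; both traverse edge 1, in opposite directions.  The sign \<open>\<sigma>\<close> exchanges sources
  and sinks, which reverses all routes.\<close>

definition gadget :: "real \<Rightarrow> real \<Rightarrow> (nat, nat) unetwork" where
  "gadget \<epsilon> \<sigma> =
    \<lparr>graph = \<lparr>nodes = {0, 1, 2, 3}, edges = {0, 1, 2, 3},
       ends = (\<lambda>e. if e = 0 then {0, 1} else if e = 1 then {1, 2} else if e = 2 then {0, 2} else {2, 3})\<rparr>,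
     capacity = (\<lambda>e. if e = 0 then 1 else if e = 1 then 1 + 1 / \<epsilon> else if e = 2 then 1 / \<epsilon> else 1),
     balance = (\<lambda>v. \<sigma> * (if v = 0 then 2 else if v = 1 \<or> v = 3 then -1 else 0)),
     transit = (\<lambda>e. if e = 2 then 1 else if e = 3 then \<epsilon> else 0),
     horizon = 1 + \<epsilon>\<rparr>"

lemma gadget_simps:
  "nodes (graph (gadget \<epsilon> \<sigma>)) = {0, 1, 2, 3}" "edges (graph (gadget \<epsilon> \<sigma>)) = {0, 1, 2, 3}"
  "ends (graph (gadget \<epsilon> \<sigma>)) e = (if e = 0 then {0, 1} else if e = 1 then {1, 2} else if e = 2 then {0, 2} else {2, 3})"
  "capacity (gadget \<epsilon> \<sigma>) e = (if e = 0 then 1 else if e = 1 then 1 + 1 / \<epsilon> else if e = 2 then 1 / \<epsilon> else 1)"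
  "balance (gadget \<epsilon> \<sigma>) v = \<sigma> * (if v = 0 then 2 else if v = 1 \<or> v = 3 then -1 else 0)"
  "transit (gadget \<epsilon> \<sigma>) e = (if e = 2 then 1 else if e = 3 then \<epsilon> else 0)"
  "horizon (gadget \<epsilon> \<sigma>) = 1 + \<epsilon>"
  by (simp_all add: gadget_def)

lemma undirected_network_gadget: "0 < \<epsilon> \<Longrightarrow> undirected_network (gadget \<epsilon> \<sigma>)"
  by unfold_locales (auto simp: gadget_simps split: if_splits)

lemma gadget_terminals:
  "sources (gadget \<epsilon> 1) = {0}" "sinks (gadget \<epsilon> 1) = {1, 3}"
  "sources (gadget \<epsilon> (-1)) = {1, 3}" "sinks (gadget \<epsilon> (-1)) = {0}"
  by (auto simp: sources_def sinks_def gadget_simps split: if_splits)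

lemma gadget_supply: "total_supply (gadget \<epsilon> 1) = 2" "total_supply (gadget \<epsilon> (-1)) = 2"
  unfolding total_supply_def gadget_terminals by (simp_all add: gadget_simps)

lemma count_list_map_fst:
  assumes "d \<noteq> d'"
  shows "count_list p (e, d) + count_list p (e, d') \<le> count_list (map fst p) e"
  using assms by (induction p) auto

text \<open>This explains the capacities. \<open>P\<close> takes time \<open>\<epsilon>\<close> and
  can send for a period 1 at rate 1; \<open>Q\<close> takes time 1 and can send only for a period
  \<open>\<epsilon>\<close>, hence at rate \<open>1 / \<epsilon>\<close>. Each carries one unit, and
  together they fill edge 1.\<close>

lemma can_send_undirected_gadget:
  fixes P Q :: "(nat, nat \<times> nat \<times> nat) route"
  assumes \<epsilon>: "0 < \<epsilon>"
    and PQ: "\<sigma> = 1 \<and> P = (0, [(0, 0, 1), (1, 1, 2), (3, 2, 3)], 3) \<and> Q = (0, [(2, 0, 2), (1, 2, 1)], 1) \<or>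
      \<sigma> = -1 \<and> P = (3, [(3, 3, 2), (1, 2, 1), (0, 1, 0)], 0) \<and> Q = (1, [(1, 1, 2), (2, 2, 0)], 0)"
  shows "can_send_undirected (gadget \<epsilon> \<sigma>) 2"
proof -
  let ?N = "gadget \<epsilon> \<sigma>"
  interpret undirected_network ?N by (rule undirected_network_gadget[OF \<epsilon>])
  let ?M = "bidirection ?N" and ?R = "{P, Q}" and ?x = "\<lambda>S. if S = P then 1 else 1 / \<epsilon>"
  have ne: "P \<noteq> Q" using PQ by auto
  have sum_R: "(\<Sum>S\<in>?R. ?x S * F S) = F P + F Q / \<epsilon>" for F
    using ne by simp
  have sum_filter: "(\<Sum>S | S \<in> ?R \<and> B S. ?x S * F S) =
      (if B P then F P else 0) + (if B Q then F Q / \<epsilon> else 0)" for B F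
  proof -
    have "(\<Sum>S | S \<in> ?R \<and> B S. ?x S * F S) = (\<Sum>S\<in>?R. if B S then ?x S * F S else 0)"
      by (rule sum.inter_filter) simp
    then show ?thesis using ne by simp
  qed
  have count: "real (count_list (map fst (walk P)) e) = (if e = 2 then 0 else 1)"
    "real (count_list (map fst (walk Q)) e) = (if e \<in> {1, 2} then 1 else 0)" if "e \<in> {0, 1, 2, 3}" for e
    using that PQ by auto
  \<comment> \<open>For the two directions of an edge this is the shared capacity; with an arbitrary
    second direction \<open>d'\<close> it also bounds a single arc.\<close>
  have load: "(\<Sum>S\<in>?R. ?x S * real (count_list (walk S) (e, d)))
      + (\<Sum>S\<in>?R. ?x S * real (count_list (walk S) (e, d'))) \<le> capacity ?N e"
    if e: "e \<in> {0, 1, 2, 3}" and d: "d \<noteq> d'" for e d d'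
  proof -
    have le: "real (count_list p (e, d)) + real (count_list p (e, d')) \<le> real (count_list (map fst p) e)"
      for p :: "(nat \<times> nat \<times> nat) list"
      using count_list_map_fst[OF d, of p e] by linarith
    have "(\<Sum>S\<in>?R. ?x S * real (count_list (walk S) (e, d)))
        + (\<Sum>S\<in>?R. ?x S * real (count_list (walk S) (e, d')))
      = (real (count_list (walk P) (e, d)) + real (count_list (walk P) (e, d')))
        + (real (count_list (walk Q) (e, d)) + real (count_list (walk Q) (e, d'))) / \<epsilon>"
      unfolding sum_R by (simp add: add_divide_distrib)
    also have "\<dots> \<le> real (count_list (map fst (walk P)) e) + real (count_list (map fst (walk Q)) e) / \<epsilon>"
      by (intro add_mono divide_right_mono le) (use \<epsilon> in simp)
    also have "\<dots> \<le> capacity ?N e"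
      unfolding count[OF e] using e by (auto simp: gadget_simps)
    finally show ?thesis .
  qed
  have duration: "horizon ?M - sum_list (map (transit ?M) (walk P)) = 1"
    "horizon ?M - sum_list (map (transit ?M) (walk Q)) = \<epsilon>"
    using PQ by (auto simp: gadget_simps)
  interpret repeated_routes ?M ?R ?x
  proof
    fix a assume a: "a \<in> arcs bi"
    show "0 \<le> transit ?M a" using transit_nonneg a by simp
    obtain e d where aa: "a = (e, d)" by (cases a) auto
    obtain d' :: "nat \<times> nat" where d': "d \<noteq> d'" by (metis prod.inject n_not_Suc_n surj_pair)
    have "0 \<le> (\<Sum>S\<in>?R. ?x S * real (count_list (walk S) (e, d')))"
      by (intro sum_nonneg mult_nonneg_nonneg) (use \<epsilon> in auto)
    then show "(\<Sum>S\<in>?R. ?x S * real (count_list (walk S) a)) \<le> capacity ?M a"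
      using load[OF _ d', of e] a by (simp add: aa gadget_simps(2))
  next
    fix S assume S: "S \<in> ?R"
    show "bi.awalk (start S) (walk S) (target S)" "0 < balance ?M (start S)" "balance ?M (target S) < 0"
      using S PQ by (auto simp: bi.awalk_def pre_digraph.cas.simps gadget_simps insert_commute)
    show "0 \<le> ?x S" using \<epsilon> by simp
    show "sum_list (map (transit ?M) (walk S)) \<le> horizon ?M" using S duration \<epsilon> by auto
  next
    fix v
    show "(\<Sum>S | S \<in> ?R \<and> start S = v. ?x S * (horizon ?M - sum_list (map (transit ?M) (walk S)))) \<le> balance ?M v"
      if "0 < balance ?M v"
      unfolding sum_filter duration using that PQ \<epsilon> by (auto simp: gadget_simps split: if_splits)
    show "(\<Sum>S | S \<in> ?R \<and> target S = v. ?x S * (horizon ?M - sum_list (map (transit ?M) (walk S)))) \<le> - balance ?M v"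
      if "balance ?M v < 0"
      unfolding sum_filter duration using that PQ \<epsilon> by (auto simp: gadget_simps split: if_splits)
  qed simp
  let ?f = "repeated ?M ?R ?x"
  have "undirected_flow_over_time ?N ?f"
    unfolding undirected_flow_over_time_def
  proof (intro conjI ballI flow_over_time_repeated)
    fix e \<theta> assume e: "e \<in> edges (graph ?N)"
    obtain p q where pq: "ends (graph ?N) e = {p, q}" "p < q"
      using e by (auto simp: gadget_simps intro: that[of 0 1] that[of 1 2] that[of 0 2] that[of 2 3])
    have "{(v, w). ends (graph ?N) e = {v, w}} = {(p, q), (q, p)}"
      unfolding pq(1) by (auto simp: doubleton_eq_iff)
    then have "(\<Sum>(v, w) | ends (graph ?N) e = {v, w}. ?f (e, v, w) \<theta>) = ?f (e, p, q) \<theta> + ?f (e, q, p) \<theta>"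
      using pq(2) by simp
    also have "\<dots> \<le> capacity ?N e"
      by (rule order_trans[OF add_mono[OF repeated_le_count repeated_le_count] load])
        (use e pq(2) in \<open>auto simp: gadget_simps\<close>)
    finally show "(\<Sum>(v, w) | ends (graph ?N) e = {v, w}. ?f (e, v, w) \<theta>) \<le> capacity ?N e" .
  qed
  moreover have "flow_value ?M ?f = 2"
    unfolding flow_value_repeated sum_R duration using \<epsilon> by simp
  ultimately show ?thesis unfolding can_send_undirected_def by force
qed

text \<open>The conditions on the cut times prevent crossings of edges 2 and 3 either way and of
  edge 1 in its chosen direction. What remains is edge 0, of capacity 1 and transit time 0, crossed
  for a period of at most \<open>D\<close>.\<close>

lemma gadget_cut:
  assumes \<epsilon>: "0 < \<epsilon>" and M: "orientation (gadget \<epsilon> \<sigma>) M" and f: "flow_over_time M f"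
    and range: "{h0, h1, h2, h3} \<subseteq> {0..1 + \<epsilon>}"
    and edge: "\<bar>h0 - h1\<bar> \<le> D" "tail (graph M) 1 = 1 \<Longrightarrow> h2 \<le> h1" "tail (graph M) 1 = 2 \<Longrightarrow> h1 \<le> h2"
      "\<bar>h0 - h2\<bar> \<le> 1" "\<bar>h2 - h3\<bar> \<le> \<epsilon>"
  shows "excess M f 0 h0 + excess M f 1 h1 + excess M f 2 h2 + excess M f 3 h3 \<le> D"
proof -
  have M_simps: "verts (graph M) = {0, 1, 2, 3}" "arcs (graph M) = {0, 1, 2, 3}"
    "capacity M = capacity (gadget \<epsilon> \<sigma>)" "transit M = transit (gadget \<epsilon> \<sigma>)" "horizon M = 1 + \<epsilon>"
    using M by (auto simp: orientation_def gadget_simps)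
  have tips: "{tail (graph M) e, head (graph M) e} = ends (graph (gadget \<epsilon> \<sigma>)) e" if "e \<in> {0, 1, 2, 3}" for e
    using M that M_simps(2) by (simp add: orientation_def)
  have fin: "fin_digraph (graph M)"
  proof
    show "tail (graph M) e \<in> verts (graph M)" "head (graph M) e \<in> verts (graph M)" if "e \<in> arcs (graph M)" for e
      using that tips[of e] by (auto simp: M_simps gadget_simps doubleton_eq_iff split: if_splits)
  qed (simp_all add: M_simps)
  define h where "h v = (if v = 0 then h0 else if v = 1 then h1 else if v = 2 then h2 else h3)" for v :: nat
  define d where "d a = h (head (graph M) a) - transit M a - h (tail (graph M) a)" for a
  have "d 0 \<le> D"
    using tips[of 0] edge(1) by (auto simp: d_def h_def M_simps gadget_simps doubleton_eq_iff)
  moreover have "d 1 \<le> 0"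
    using tips[of 1] edge(2,3) by (auto simp: d_def h_def M_simps gadget_simps doubleton_eq_iff)
  moreover have "d 2 \<le> 0"
    using tips[of 2] edge(4) by (auto simp: d_def h_def M_simps gadget_simps doubleton_eq_iff)
  moreover have "d 3 \<le> 0"
    using tips[of 3] edge(5) by (auto simp: d_def h_def M_simps gadget_simps doubleton_eq_iff)
  moreover have "(\<Sum>v\<in>verts (graph M). excess M f v (h v)) \<le> (\<Sum>a\<in>arcs (graph M). capacity M a * max 0 (d a))"
    unfolding d_def
    by (rule excess_cut[OF fin f]) (use range \<epsilon> in \<open>auto simp: M_simps gadget_simps h_def\<close>)
  ultimately show ?thesis
    using edge(1) by (simp add: M_simps(1-3) gadget_simps h_def max_def split: if_splits)
qed

text \<open>One direction of edge 1 blocks the exchange between 0 and 3 within the horizon, leaving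
  only the unit of node 1. In the other, all flow that counts passes edge 0 at rate at most 1 within
  \<open>1 + \<epsilon>\<close>.\<close>

lemma gadget_value:
  assumes \<epsilon>: "0 < \<epsilon>" and \<sigma>: "\<sigma> = 1 \<or> \<sigma> = -1"
    and M: "orientation (gadget \<epsilon> \<sigma>) M" and f: "flow_over_time M f"
  shows "flow_value M f \<le> 1 + \<epsilon>"
proof -
  have M_simps: "verts (graph M) = {0, 1, 2, 3}" "arcs (graph M) = {0, 1, 2, 3}" "balance M = balance (gadget \<epsilon> \<sigma>)"
    "transit M = transit (gadget \<epsilon> \<sigma>)" "horizon M = 1 + \<epsilon>"
    using M by (auto simp: orientation_def gadget_simps)
  have tip: "tail (graph M) 1 = 1 \<or> tail (graph M) 1 = 2"
    using M by (auto simp: orientation_def gadget_simps doubleton_eq_iff)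
  have start: "excess M f v 0 = 0" for v
    by (rule excess_start) (use \<epsilon> in \<open>auto simp: M_simps gadget_simps\<close>)
  have conserves: "conserves_at M f v" if "v \<in> {0, 1, 2, 3}" for v
    using f that unfolding flow_over_time_def M_simps by blast
  have inner: "0 \<le> excess M f 2 \<theta>" if "\<theta> \<in> {0..1 + \<epsilon>}" for \<theta>
    using conserves[of 2] that by (simp add: conserves_at_def M_simps gadget_simps)
  note cut = gadget_cut[OF \<epsilon> M f]
  from \<sigma> show ?thesis
  proof
    assume \<sigma>: "\<sigma> = 1"
    have "{v \<in> verts (graph M). balance M v < 0} = {1, 3}"
      using \<sigma> by (auto simp: M_simps gadget_simps split: if_splits)
    then have val: "flow_value M f = excess M f 1 (1 + \<epsilon>) + excess M f 3 (1 + \<epsilon>)"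
      by (simp add: flow_value_def M_simps)
    from tip show ?thesis
    proof
      assume dir: "tail (graph M) 1 = 1"
      \<comment> \<open>The time 1 at node 2 is forced: at most 1 away from time 0 along edge 2, and
        at most \<open>\<epsilon>\<close> from the horizon along edge 3.\<close>
      have "excess M f 0 0 + excess M f 1 (1 + \<epsilon>) + excess M f 2 1 + excess M f 3 (1 + \<epsilon>) \<le> 1 + \<epsilon>"
        by (rule cut) (use dir \<epsilon> in simp_all)
      then show ?thesis using start inner[of 1] \<epsilon> val by simp
    next
      assume dir: "tail (graph M) 1 = 2"
      have "excess M f 0 0 + excess M f 1 0 + excess M f 2 1 + excess M f 3 (1 + \<epsilon>) \<le> 0"
        by (rule cut) (use dir \<epsilon> in simp_all)
      moreover have "excess M f 1 (1 + \<epsilon>) \<le> 1"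
        using conserves[of 1] \<epsilon> \<sigma> by (simp add: conserves_at_def M_simps gadget_simps)
      ultimately show ?thesis using start inner[of 1] \<epsilon> val by simp
    qed
  next
    assume \<sigma>: "\<sigma> = -1"
    have "{v \<in> verts (graph M). balance M v < 0} = {0}"
      using \<sigma> by (auto simp: M_simps gadget_simps split: if_splits)
    then have val: "flow_value M f = excess M f 0 (1 + \<epsilon>)"
      by (simp add: flow_value_def M_simps)
    from tip show ?thesis
    proof
      assume dir: "tail (graph M) 1 = 1"
      \<comment> \<open>With the end times of 0 and 3 exchanged, the same two edges force time
        \<open>\<epsilon>\<close> at node 2.\<close>
      have "excess M f 0 (1 + \<epsilon>) + excess M f 1 (1 + \<epsilon>) + excess M f 2 \<epsilon> + excess M f 3 0 \<le> 0"
        by (rule cut) (use dir \<epsilon> in simp_all)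
      moreover have "- 1 \<le> excess M f 1 (1 + \<epsilon>)"
        using conserves[of 1] \<epsilon> \<sigma> by (simp add: conserves_at_def M_simps gadget_simps)
      ultimately show ?thesis using start inner[of \<epsilon>] \<epsilon> val by simp
    next
      assume dir: "tail (graph M) 1 = 2"
      have "excess M f 0 (1 + \<epsilon>) + excess M f 1 0 + excess M f 2 \<epsilon> + excess M f 3 0 \<le> 1 + \<epsilon>"
        by (rule cut) (use dir \<epsilon> in simp_all)
      then show ?thesis using start inner[of \<epsilon>] \<epsilon> val by simp
    qed
  qed
qed

text \<open>For \<open>\<epsilon> = c - 1 / 2\<close>, the amount \<open>c * 2\<close> is
  \<open>1 + 2 * \<epsilon>\<close>, which exceeds the bound \<open>1 + \<epsilon>\<close>.\<close>

lemma gadget_orientation_bound: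
  assumes "1 / 2 < c" "\<sigma> = 1 \<or> \<sigma> = -1" "orientation (gadget (c - 1 / 2) \<sigma>) M"
  shows "\<not> can_send M (c * 2)"
  using gadget_value[OF _ assms(2,3)] assms(1) unfolding can_send_def by force

theorem theorem3:
  "(\<forall>N :: ('v, 'e) unetwork.
      undirected_network N \<and> (card (sources N) = 1 \<or> card (sinks N) = 1) \<and>
      can_send_undirected N (total_supply N) \<longrightarrow>
      (\<exists>M. orientation N M \<and> can_send M (total_supply N / 2)))
   \<and>
   (\<forall>c > 1 / 2.
      (\<exists>N :: (nat, nat) unetwork.
         undirected_network N \<and> card (sources N) = 1 \<and>
         can_send_undirected N (total_supply N) \<and>
         (\<forall>M. orientation N M \<longrightarrow> \<not> can_send M (c * total_supply N)))
      \<and>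
      (\<exists>N :: (nat, nat) unetwork.
         undirected_network N \<and> card (sinks N) = 1 \<and>
         can_send_undirected N (total_supply N) \<and>
         (\<forall>M. orientation N M \<longrightarrow> \<not> can_send M (c * total_supply N))))"
proof (intro conjI allI impI)
  fix N :: "('v, 'e) unetwork"
  assume N: "undirected_network N \<and> (card (sources N) = 1 \<or> card (sinks N) = 1) \<and>
    can_send_undirected N (total_supply N)"
  then interpret undirected_network N by blast
  show "\<exists>M. orientation N M \<and> can_send M (total_supply N / 2)"
    using N by (intro orientation_sending_half) auto
next
  fix c :: real assume c: "1 / 2 < c"
  then have \<epsilon>: "0 < c - 1 / 2" by simp
  note bound = gadget_orientation_bound[OF c]
  show "\<exists>N :: (nat, nat) unetwork. undirected_network N \<and> card (sources N) = 1 \<and>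
      can_send_undirected N (total_supply N) \<and>
      (\<forall>M. orientation N M \<longrightarrow> \<not> can_send M (c * total_supply N))"
    using undirected_network_gadget[OF \<epsilon>] can_send_undirected_gadget[OF \<epsilon>, of 1] bound[of 1]
    by (intro exI[of _ "gadget (c - 1 / 2) 1"]) (simp add: gadget_terminals gadget_supply)
  show "\<exists>N :: (nat, nat) unetwork. undirected_network N \<and> card (sinks N) = 1 \<and>
      can_send_undirected N (total_supply N) \<and>
      (\<forall>M. orientation N M \<longrightarrow> \<not> can_send M (c * total_supply N))"
    using undirected_network_gadget[OF \<epsilon>] can_send_undirected_gadget[OF \<epsilon>, of "-1"] bound[of "-1"]
    by (intro exI[of _ "gadget (c - 1 / 2) (-1)"]) (simp add: gadget_terminals gadget_supply)
qed

end
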